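(* For every positive integer $n$ and every real number $k$ with $2 \le k \le \frac{1}{648}\log\log n$ there is an $n$-vertex graph $G=G_{n,k}$ satisfying: (i) $G$ has average degree at least $k$ and maximum degree at most $6k$. (ii) $G$ has girth at least $\log n/(6k)^2$. (iii) Every $t$-vertex subgraph $H$ of $G$ with $t\ge \log n/(6k)^2$ satisfies $$\mathrm{sep}_V(H) \le \mathrm{sep}_E(H)\le \frac{t}{\log t}\cdot(\log\log t)^2 .$$
   Context: Graphs are finite, simple and undirected; subgraphs are not necessarily induced; $\log$ denotes $\log_2$. The girth of a graph is the minimum length of a cycle in it. An edge separator in a graph $G=(V,E)$ is a set of edges whose removal disconnects $G$ into two (not necessarily connected) subgraphs each on at most $\frac23|V|$ vertices; that is, a set $F\subseteq E$ for which there is a partition $V=A\cup B$ with $|A|,|B|\le\frac23|V|$ and no edge of $E\setminus F$ between $A$ and $B$. $\mathrm{sep}_E(G)$ is the minimum cardinality of an edge separator in $G$. A vertex separator is defined in the same way with vertices removed rather than edges: a set $S\subseteq V$ such that $V\setminus S$ can be partitioned into two sets $A,B$ with $|A|,|B|\le\frac23|V|$ and no edge of $G$ between $A$ and $B$. $\mathrm{sep}_V(G)$ is the minimum cardinality of a vertex separator in $G$. *)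

theory Defs
  imports Complex_Main "HOL-Library.Extended_Nat" "HOL-Library.Extended_Real"
begin

text \<open>A graph is a vertex set \<open>V\<close> together with a set \<open>E\<close> of two-element subsets of \<open>V\<close>.\<close>

definition simple_graph :: "'a set \<Rightarrow> 'a set set \<Rightarrow> bool" where
  "simple_graph V E \<longleftrightarrow> finite V \<and> (\<forall>e\<in>E. e \<subseteq> V \<and> card e = 2)"

definition is_subgraph :: "'a set \<Rightarrow> 'a set set \<Rightarrow> 'a set \<Rightarrow> 'a set set \<Rightarrow> bool" where
  "is_subgraph W F V E \<longleftrightarrow> simple_graph W F \<and> W \<subseteq> V \<and> F \<subseteq> E"

definition degree :: "'a set set \<Rightarrow> 'a \<Rightarrow> nat" where
  "degree E v = card {e \<in> E. v \<in> e}"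

definition average_degree :: "'a set \<Rightarrow> 'a set set \<Rightarrow> real" where
  "average_degree V E = (\<Sum>v\<in>V. real (degree E v)) / real (card V)"

definition max_degree :: "'a set \<Rightarrow> 'a set set \<Rightarrow> nat" where
  "max_degree V E = Max (degree E ` V)"

definition is_cycle :: "'a set set \<Rightarrow> 'a list \<Rightarrow> bool" where
  "is_cycle E xs \<longleftrightarrow> 3 \<le> length xs \<and> distinct xs \<and>
     (\<forall>i<length xs. {xs ! i, xs ! (Suc i mod length xs)} \<in> E)"

text \<open>The girth of an acyclic graph is \<open>\<infinity>\<close>.\<close>

definition girth :: "'a set set \<Rightarrow> enat" where
  "girth E = (INF xs\<in>{xs. is_cycle E xs}. enat (length xs))"

definition edge_separator :: "'a set \<Rightarrow> 'a set set \<Rightarrow> 'a set set \<Rightarrow> bool" where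
  "edge_separator V E F \<longleftrightarrow> F \<subseteq> E \<and>
     (\<exists>A B. A \<union> B = V \<and> A \<inter> B = {} \<and>
        real (card A) \<le> 2 / 3 * real (card V) \<and>
        real (card B) \<le> 2 / 3 * real (card V) \<and>
        (\<forall>a\<in>A. \<forall>b\<in>B. {a, b} \<notin> E - F))"

definition vertex_separator :: "'a set \<Rightarrow> 'a set set \<Rightarrow> 'a set \<Rightarrow> bool" where
  "vertex_separator V E S \<longleftrightarrow> S \<subseteq> V \<and>
     (\<exists>A B. A \<union> B = V - S \<and> A \<inter> B = {} \<and>
        real (card A) \<le> 2 / 3 * real (card V) \<and>
        real (card B) \<le> 2 / 3 * real (card V) \<and>
        (\<forall>a\<in>A. \<forall>b\<in>B. {a, b} \<notin> E))"

text \<open>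
  The minimum over an empty family is \<open>\<infinity>\<close>; this happens only for edge separators of the
  one-vertex graph, so a finite upper bound on \<open>sep_E\<close> entails that a separator exists.
\<close>

definition sep_E :: "'a set \<Rightarrow> 'a set set \<Rightarrow> enat" where
  "sep_E V E = (INF F\<in>{F. edge_separator V E F}. enat (card F))"

definition sep_V :: "'a set \<Rightarrow> 'a set set \<Rightarrow> enat" where
  "sep_V V E = (INF S\<in>{S. vertex_separator V E S}. enat (card S))"

end

theory Submission
  imports Defs
begin

text \<open>
  \<open>G\<close> is a random subgraph, with edge probability \<open>3 k / d\<close>, of the hypercube of dimension
  \<open>d = \<lfloor>log n\<rfloor>\<close>, from which one edge of every short cycle and the excess edges at vertices of
  large degree are deleted; at most half of the \<open>n\<close> vertices are outside the cube and stay
  isolated. A cycle of length \<open>2 l\<close> in the cube uses every direction an even number of times, so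
  there are at most \<open>2\<^sup>d (2 l d)\<^sup>l\<close> of them, few enough for the deletions to be harmless up to
  length \<open>log n / (6 k)\<^sup>2\<close>.

  A balanced edge separator of a \<open>t\<close>-vertex subgraph is obtained by removing sparse cuts one after
  the other. If \<open>log log t \<ge> (log log n) / 4\<close>, some coordinate of the cube gives a sparse cut: Hamming
  balls of radius \<open>r\<close> have at most \<open>(d + 1)\<^sup>r\<close> points, so the average Hamming distance in a set of
  about \<open>t\<close> vertices is of order \<open>log t / log d\<close>, while every edge crosses a single coordinate. If
  \<open>t\<close> is smaller, the girth is much larger than \<open>log t\<close>, and a ball with small boundary is either
  itself a sparse cut or a tree, which has a subtree that can be cut off at a single edge.
\<close>

section \<open>Balanced separators from sparse cuts\<close>

definition edge_cut :: "'a set set \<Rightarrow> 'a set \<Rightarrow> 'a set \<Rightarrow> 'a set set" where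
  "edge_cut F A B = {e \<in> F. \<exists>a\<in>A. \<exists>b\<in>B. e = {a, b}}"

lemma simple_graph_finite_edges:
  assumes "simple_graph V E"
  shows "finite E"
proof -
  have "E \<subseteq> Pow V" "finite V" using assms by (auto simp: simple_graph_def)
  then show ?thesis by (meson finite_Pow_iff finite_subset)
qed

lemma finite_edge_cut: "finite F \<Longrightarrow> finite (edge_cut F A B)"
  by (simp add: edge_cut_def)

text \<open>Replacing every separating edge between \<open>A\<close> and \<open>B\<close> by its end
  in \<open>A\<close>, and deleting these ends from \<open>A\<close>, turns an edge separator into a
  vertex separator that is no larger; \<open>B\<close> stays as it is.\<close>

lemma sep_V_le_sep_E:
  assumes G: "simple_graph V E"
  shows "sep_V V E \<le> sep_E V E"
  unfolding sep_E_def
proof (rule INF_greatest)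
  fix F assume "F \<in> {F. edge_separator V E F}"
  then obtain A B where F: "F \<subseteq> E" and AB: "A \<union> B = V" "A \<inter> B = {}"
    "real (card A) \<le> 2 / 3 * real (card V)" "real (card B) \<le> 2 / 3 * real (card V)"
    "\<forall>a\<in>A. \<forall>b\<in>B. {a, b} \<notin> E - F"
    by (auto simp: edge_separator_def)
  have finF: "finite F" using simple_graph_finite_edges[OF G] F finite_subset by blast
  have finA: "finite A" using G AB by (auto simp: simple_graph_def)
  \<comment> \<open>\<open>A\<close> and \<open>B\<close> are disjoint, so each edge of the cut has
    exactly one end in \<open>A\<close> and the choice is forced.\<close>
  define S where "S = (\<lambda>e. SOME a. a \<in> A \<and> a \<in> e) ` edge_cut F A B"
  have SA: "S \<subseteq> A"
  proof
    fix x assume "x \<in> S"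
    then obtain e where e: "e \<in> edge_cut F A B" "x = (SOME a. a \<in> A \<and> a \<in> e)" by (auto simp: S_def)
    then have "\<exists>a. a \<in> A \<and> a \<in> e" by (auto simp: edge_cut_def)
    from someI_ex[OF this] show "x \<in> A" using e by auto
  qed
  have "vertex_separator V E S"
    unfolding vertex_separator_def
  proof (intro conjI exI)
    show "S \<subseteq> V" using SA AB by auto
    show "(A - S) \<union> B = V - S" "(A - S) \<inter> B = {}" using SA AB by auto
    have "card (A - S) \<le> card A" using finA by (simp add: card_mono)
    then show "real (card (A - S)) \<le> 2 / 3 * real (card V)" using AB(3) by linarith
    show "real (card B) \<le> 2 / 3 * real (card V)" by (rule AB)
    show "\<forall>a\<in>A - S. \<forall>b\<in>B. {a, b} \<notin> E"
    proof (intro ballI notI)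
      fix a b assume ab: "a \<in> A - S" "b \<in> B" "{a, b} \<in> E"
      then have "{a, b} \<in> edge_cut F A B" using AB(5) by (auto simp: edge_cut_def)
      moreover have "(SOME x. x \<in> A \<and> x \<in> {a, b}) = a"
        using ab AB(2) by (intro some_equality) auto
      ultimately show False using ab by (auto simp: S_def intro: rev_image_eqI)
    qed
  qed
  moreover have "card S \<le> card F"
  proof -
    have "card S \<le> card (edge_cut F A B)" unfolding S_def using finF by (intro card_image_le finite_edge_cut)
    also have "\<dots> \<le> card F" using finF by (intro card_mono) (auto simp: edge_cut_def)
    finally show ?thesis .
  qed
  ultimately show "sep_V V E \<le> enat (card F)"
    unfolding sep_V_def by (intro INF_lower2[of S]) auto
qed

text \<open>Removing sparse pieces one at a time as long as more than two thirds of the vertices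
  remain; the piece that crosses the threshold is at most half of what is left, so at least one
  third remains.\<close>

lemma sep_E_le_of_sparse_cuts:
  fixes \<alpha> :: real
  assumes G: "simple_graph W F" and \<alpha>: "0 \<le> \<alpha>"
    and cuts: "\<And>U. U \<subseteq> W \<Longrightarrow> 2 / 3 * real (card W) < real (card U) \<Longrightarrow>
      \<exists>X\<subseteq>U. X \<noteq> {} \<and> 2 * card X \<le> card U \<and> real (card (edge_cut F X (U - X))) \<le> \<alpha> * real (card X)"
  shows "ereal_of_enat (sep_E W F) \<le> ereal (2 / 3 * \<alpha> * real (card W))"
proof -
  have finW: "finite W" using G by (simp add: simple_graph_def)
  have finF: "finite F" by (rule simple_graph_finite_edges[OF G])
  \<comment> \<open>Each removed piece pays for its own cut, so the cut of \<open>Y\<close> is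
    charged to the vertices outside \<open>Y\<close>. For \<open>U = W\<close> these are at most two
    thirds of \<open>W\<close>, which is the factor 2/3 in the bound.\<close>
  have *: "\<exists>Y\<subseteq>U. real (card W) / 3 \<le> real (card Y) \<and> real (card Y) \<le> 2 / 3 * real (card W) \<and>
      real (card (edge_cut F Y (U - Y))) \<le> \<alpha> * real (card (U - Y))"
    if "U \<subseteq> W" "real (card W) / 3 \<le> real (card U)" for U
    using that
  proof (induction "card U" arbitrary: U rule: less_induct)
    case less
    show ?case
    proof (cases "real (card U) \<le> 2 / 3 * real (card W)")
      case True
      have "edge_cut F U (U - U) = {}" by (auto simp: edge_cut_def)
      then show ?thesis using True less by (intro exI[of _ U]) auto
    next
      case False
      then obtain X where X: "X \<subseteq> U" "X \<noteq> {}" "2 * card X \<le> card U"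
        "real (card (edge_cut F X (U - X))) \<le> \<alpha> * real (card X)"
        using cuts[of U] less by auto
      have finU: "finite U" using less finW finite_subset by blast
      then have finX: "finite X" using X finite_subset by blast
      have cX: "card X > 0" using X finX by auto
      have cU: "card (U - X) = card U - card X" "card X \<le> card U"
        using X finX finU by (auto simp: card_Diff_subset card_mono)
      have "card (U - X) < card U" using cU cX by linarith
      moreover have "real (card W) / 3 \<le> real (card (U - X))" using cU X False by linarith
      ultimately obtain Y where Y: "Y \<subseteq> U - X" "real (card W) / 3 \<le> real (card Y)"
        "real (card Y) \<le> 2 / 3 * real (card W)"
        "real (card (edge_cut F Y (U - X - Y))) \<le> \<alpha> * real (card (U - X - Y))"
        using less(1)[of "U - X"] less(2) by auto
      \<comment> \<open>An edge leaving \<open>Y\<close> ends in \<open>X\<close> or outside it; in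
        the first case it belongs to the cut of \<open>X\<close>, since \<open>Y\<close> avoids
        \<open>X\<close>.\<close>
      have "edge_cut F Y (U - Y) \<subseteq> edge_cut F Y (U - X - Y) \<union> edge_cut F X (U - X)"
        using Y(1) by (fastforce simp: edge_cut_def doubleton_eq_iff)
      then have "card (edge_cut F Y (U - Y)) \<le> card (edge_cut F Y (U - X - Y)) + card (edge_cut F X (U - X))"
        by (meson card_Un_le card_mono finF finite_UnI finite_edge_cut order_trans)
      then have 1: "real (card (edge_cut F Y (U - Y))) \<le> \<alpha> * (real (card (U - X - Y)) + real (card X))"
        using X(4) Y(4) by (simp add: algebra_simps)
      have "U - Y = (U - X - Y) \<union> X" using X Y by auto
      moreover have "card ((U - X - Y) \<union> X) = card (U - X - Y) + card X"
        using finU finX by (intro card_Un_disjoint) auto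
      ultimately have "real (card (U - X - Y)) + real (card X) = real (card (U - Y))" by simp
      then show ?thesis using 1 Y by (intro exI[of _ Y]) auto
    qed
  qed
  obtain Y where Y: "Y \<subseteq> W" "real (card W) / 3 \<le> real (card Y)"
    "real (card Y) \<le> 2 / 3 * real (card W)"
    "real (card (edge_cut F Y (W - Y))) \<le> \<alpha> * real (card (W - Y))"
    using *[of W] by auto
  have cWY: "real (card (W - Y)) = real (card W) - real (card Y)"
    using Y finW by (simp add: card_Diff_subset finite_subset card_mono of_nat_diff)
  have "edge_separator W F (edge_cut F Y (W - Y))"
    unfolding edge_separator_def
    using Y cWY by (intro conjI exI[of _ Y] exI[of _ "W - Y"]) (auto simp: edge_cut_def)
  then have "sep_E W F \<le> enat (card (edge_cut F Y (W - Y)))"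
    unfolding sep_E_def by (intro INF_lower) auto
  then have "ereal_of_enat (sep_E W F) \<le> ereal (real (card (edge_cut F Y (W - Y))))"
    by (metis ereal_of_enat_le_iff ereal_of_enat_simps(1))
  also have "real (card (edge_cut F Y (W - Y))) \<le> \<alpha> * (2 / 3 * real (card W))"
    by (rule order_trans[OF Y(4)], rule mult_left_mono[OF _ \<alpha>]) (use cWY Y(2) in linarith)
  finally show ?thesis by (simp add: algebra_simps)
qed

section \<open>Coordinate cuts of the hypercube\<close>

lemma edge_cut_commute: "edge_cut F A B = edge_cut F B A"
  by (auto simp: edge_cut_def insert_commute)

lemma simple_graph_subset: "simple_graph V E \<Longrightarrow> F \<subseteq> E \<Longrightarrow> simple_graph V F"
  by (auto simp: simple_graph_def)

lemma degree_mono: "finite E \<Longrightarrow> F \<subseteq> E \<Longrightarrow> degree F v \<le> degree E v"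
  unfolding degree_def by (intro card_mono) auto

lemma handshake:
  assumes "simple_graph V E"
  shows "(\<Sum>v\<in>V. degree E v) = 2 * card E"
proof -
  have "(\<Sum>v\<in>V. card {e \<in> E. v \<in> e}) = sum (\<lambda>_. 2) E"
  proof (rule sum_multicount_gen)
    show "finite V" "finite E" using assms simple_graph_finite_edges by (auto simp: simple_graph_def)
    show "\<forall>e\<in>E. card {v \<in> V. v \<in> e} = 2"
    proof
      fix e assume "e \<in> E"
      then have "e \<subseteq> V" "card e = 2" using assms by (auto simp: simple_graph_def)
      moreover have "{v \<in> V. v \<in> e} = e" using \<open>e \<subseteq> V\<close> by auto
      ultimately show "card {v \<in> V. v \<in> e} = 2" by simp
    qed
  qed
  then show ?thesis by (simp add: degree_def)
qed

lemma card_induced_edges_le: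
  fixes D :: real
  assumes "simple_graph W F" "U \<subseteq> W" "\<And>v. v \<in> W \<Longrightarrow> real (degree F v) \<le> D"
  shows "2 * real (card {e \<in> F. e \<subseteq> U}) \<le> D * real (card U)"
proof -
  let ?F = "{e \<in> F. e \<subseteq> U}"
  have "simple_graph U ?F" using assms by (auto simp: simple_graph_def finite_subset)
  then have "2 * real (card ?F) = (\<Sum>v\<in>U. real (degree ?F v))"
    using handshake[of U ?F] by (simp flip: of_nat_sum)
  also have "\<dots> \<le> (\<Sum>v\<in>U. D)"
  proof (rule sum_mono)
    fix v assume v: "v \<in> U"
    have "degree ?F v \<le> degree F v"
      by (rule degree_mono) (use simple_graph_finite_edges[OF assms(1)] in auto)
    with assms(2,3) v show "real (degree ?F v) \<le> D" by (meson of_nat_le_iff order_trans subsetD)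
  qed
  finally show ?thesis by (simp add: mult.commute)
qed

text \<open>Every such set is the set of letters of a word of length exactly \<open>r\<close> over
  \<open>d + 1\<close> letters, where the extra letter \<open>d\<close> pads the word and is then
  discarded.\<close>

lemma card_small_subsets:
  "card {S. S \<subseteq> {..<d::nat} \<and> card S \<le> r} \<le> (d + 1) ^ r"
proof -
  have "{S. S \<subseteq> {..<d} \<and> card S \<le> r} \<subseteq> (\<lambda>l. set l - {d}) ` {l. set l \<subseteq> {..d} \<and> length l = r}"
  proof
    fix S assume "S \<in> {S. S \<subseteq> {..<d} \<and> card S \<le> r}"
    then have S: "S \<subseteq> {..<d}" "card S \<le> r" "finite S" by (auto intro: finite_subset)
    then obtain l where l: "set l = S" "distinct l" by (meson finite_distinct_list)
    then have "length l = card S" by (metis distinct_card)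
    then have "S = set (l @ replicate (r - card S) d) - {d}" "set (l @ replicate (r - card S) d) \<subseteq> {..d}"
      "length (l @ replicate (r - card S) d) = r"
      using S l by auto
    then show "S \<in> (\<lambda>l. set l - {d}) ` {l. set l \<subseteq> {..d} \<and> length l = r}" by blast
  qed
  moreover have "finite {l. set l \<subseteq> {..d} \<and> length l = r}" by (rule finite_lists_length_eq) simp
  ultimately have "card {S. S \<subseteq> {..<d} \<and> card S \<le> r} \<le> card {l. set l \<subseteq> {..d} \<and> length l = r}"
    by (rule surj_card_le[rotated])
  then show ?thesis by (simp add: card_lists_length_eq)
qed

lemma bit_nat_less_exp: "x < 2 ^ d \<Longrightarrow> bit x i \<Longrightarrow> i < d" for x :: nat
  by (metis bit_take_bit_iff take_bit_nat_eq_self)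

text \<open>Vertices of the cube are the numbers below \<open>2 ^ d\<close>; their binary digits are
  the coordinates.\<close>

definition hamming :: "nat \<Rightarrow> nat \<Rightarrow> nat \<Rightarrow> nat" where
  "hamming d x y = card {i. i < d \<and> bit x i \<noteq> bit y i}"

lemma card_hamming_ball:
  assumes x: "x < 2 ^ d"
  shows "card {y. y < 2 ^ d \<and> hamming d x y \<le> r} \<le> (d + 1) ^ r"
proof -
  let ?f = "\<lambda>y::nat. {i. i < d \<and> bit x i \<noteq> bit y i}"
  have "inj_on ?f {y::nat. y < 2 ^ d}"
  proof (rule inj_onI)
    fix y z assume yz: "y \<in> {y. y < 2 ^ d}" "z \<in> {y. y < 2 ^ d}" "?f y = ?f z"
    show "y = z"
    proof (rule bit_eqI)
      fix i
      have "i < d \<Longrightarrow> bit x i \<noteq> bit y i \<longleftrightarrow> bit x i \<noteq> bit z i" using yz(3) by blast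
      then show "bit y i \<longleftrightarrow> bit z i" using bit_nat_less_exp yz by blast
    qed
  qed
  then have "inj_on ?f {y. y < 2 ^ d \<and> hamming d x y \<le> r}" by (rule inj_on_subset) auto
  then have "card {y. y < 2 ^ d \<and> hamming d x y \<le> r} \<le> card {S. S \<subseteq> {..<d} \<and> card S \<le> r}"
    by (rule card_inj_on_le) (auto simp: hamming_def)
  with card_small_subsets show ?thesis using order_trans by blast
qed

text \<open>Double counting over the coordinates. The Hamming distances over ordered pairs in
  \<open>U\<close> add up to twice the sum of \<open>card (A i) * card (B i)\<close>. Small Hamming
  balls force this sum to be large. If every coordinate cut were dense, the cuts together would
  contain more edges than the degree bound allows inside \<open>U\<close>.\<close>

lemma hypercube_sparse_cut:
  fixes D :: real and W :: "nat set"
  assumes G: "simple_graph W F" and W: "W \<subseteq> {..<2 ^ d}"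
    and F: "\<And>e. e \<in> F \<Longrightarrow> \<exists>x i. i < d \<and> e = {x, flip_bit i x}"
    and deg: "\<And>v. v \<in> W \<Longrightarrow> real (degree F v) \<le> D"
    and U: "U \<subseteq> W" "U \<noteq> {}" and r: "2 * (d + 1) ^ r \<le> card U"
  shows "\<exists>X\<subseteq>U. X \<noteq> {} \<and> 2 * card X \<le> card U \<and>
    real (card (edge_cut F X (U - X))) \<le> 2 * D / (real r + 1) * real (card X)"
proof (rule ccontr)
  assume no: "\<not> ?thesis"
  define \<alpha> where "\<alpha> = 2 * D / (real r + 1)"
  have finU: "finite U" using G U finite_subset by (auto simp: simple_graph_def)
  have finF: "finite F" by (rule simple_graph_finite_edges[OF G])
  define u where "u = real (card U)"
  have u: "u > 0" using U finU by (auto simp: u_def card_gt_0_iff)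
  have D: "0 \<le> D" using deg U by (metis all_not_in_conv of_nat_0_le_iff order_trans subsetD)
  have \<alpha>: "\<alpha> \<ge> 0" using D by (simp add: \<alpha>_def)
  define A where "A i = {x \<in> U. bit x i}" for i
  define B where "B i = {x \<in> U. \<not> bit x i}" for i
  have AB: "A i \<union> B i = U" "A i \<inter> B i = {}" "A i \<subseteq> U" "B i \<subseteq> U" "U - A i = B i" "U - B i = A i" for i
    by (auto simp: A_def B_def)
  have finAB: "finite (A i)" "finite (B i)" for i using AB finU finite_subset by metis+
  have cAB: "card (A i) + card (B i) = card U" for i
    using card_Un_disjoint[OF finAB AB(2)] AB(1) by metis
  have sparse: "\<alpha> * real (card X) < real (card (edge_cut F X (U - X)))"
    if "X \<subseteq> U" "X \<noteq> {}" "2 * card X \<le> card U" for X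
    using no that unfolding \<alpha>_def by (meson not_less)
  have cut_gt: "\<alpha> * (real (card (A i)) * real (card (B i))) < u * real (card (edge_cut F (A i) (B i)))"
    if ne: "A i \<noteq> {}" "B i \<noteq> {}" for i
  proof -
    let ?c = "real (card (edge_cut F (A i) (B i)))"
    \<comment> \<open>Here \<open>x\<close> is the size of the smaller side, to which the failure of
      sparsity applies; the other side is bounded by \<open>u\<close>.\<close>
    have **: "\<alpha> * (x * y) < u * c" if "0 \<le> x" "0 \<le> y" "y \<le> u" "\<alpha> * x < c" for x y c :: real
    proof -
      have "\<alpha> * x * y \<le> \<alpha> * x * u" using that \<alpha> by (intro mult_left_mono) auto
      also have "\<dots> < c * u" using that u by simp
      finally show ?thesis by (simp add: algebra_simps)
    qed
    show ?thesis
    proof (cases "2 * card (A i) \<le> card U")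
      case True
      then have "\<alpha> * real (card (A i)) < ?c" using sparse[of "A i"] AB ne by metis
      then show ?thesis using **[of "real (card (A i))" "real (card (B i))" ?c] cAB[of i] by (simp add: u_def)
    next
      case False
      then have "2 * card (B i) \<le> card U" using cAB[of i] by linarith
      then have "\<alpha> * real (card (B i)) < ?c" using sparse[of "B i"] AB ne edge_cut_commute by metis
      then show ?thesis using **[of "real (card (B i))" "real (card (A i))" ?c] cAB[of i]
        by (simp add: u_def mult.commute)
    qed
  qed
  \<comment> \<open>The weak form also covers the coordinates that are constant on \<open>U\<close>,
    where the product is 0.\<close>
  have cut_ge: "\<alpha> * (real (card (A i)) * real (card (B i))) \<le> u * real (card (edge_cut F (A i) (B i)))" for i
    using cut_gt[of i] u by (cases "A i = {} \<or> B i = {}") auto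
  \<comment> \<open>An edge flips a single bit, so it crosses one coordinate only and the coordinate
    cuts are disjoint.\<close>
  have dir: "i = j" if e: "e \<in> F" "e \<in> edge_cut F (A i) (B i)" "e \<in> edge_cut F (A j) (B j)" for e i j
  proof -
    obtain x l where x: "e = {x, flip_bit l x}" using F e by blast
    have "i' = l" if i': "e \<in> edge_cut F (A i') (B i')" for i'
    proof -
      obtain a b where "a \<in> A i'" "b \<in> B i'" "e = {a, b}" using i' unfolding edge_cut_def by blast
      then show ?thesis using x by (auto simp: doubleton_eq_iff A_def B_def bit_flip_bit_iff)
    qed
    then show ?thesis using e by blast
  qed
  have "(\<Sum>i<d. card (edge_cut F (A i) (B i))) = card (\<Union>i<d. edge_cut F (A i) (B i))"
  proof (rule card_UN_disjoint[symmetric])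
    have "edge_cut F (A i) (B i) \<subseteq> F" for i by (auto simp: edge_cut_def)
    then show "\<forall>i\<in>{..<d}. \<forall>j\<in>{..<d}. i \<noteq> j \<longrightarrow>
        edge_cut F (A i) (B i) \<inter> edge_cut F (A j) (B j) = {}"
      using dir by blast
  qed (use finite_edge_cut[OF finF] in auto)
  also have "\<dots> \<le> card {e \<in> F. e \<subseteq> U}"
    using finF AB by (intro card_mono) (auto simp: edge_cut_def A_def B_def)
  finally have m: "(\<Sum>i<d. real (card (edge_cut F (A i) (B i)))) \<le> real (card {e \<in> F. e \<subseteq> U})"
    by (simp flip: of_nat_sum)
  have "(\<Sum>p\<in>U \<times> U. hamming d (fst p) (snd p)) = (\<Sum>p\<in>U \<times> U. card {i \<in> {..<d}. bit (fst p) i \<noteq> bit (snd p) i})"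
    by (simp add: hamming_def)
  also have "\<dots> = (\<Sum>i<d. 2 * (card (A i) * card (B i)))"
  proof (rule sum_multicount_gen)
    show "\<forall>i\<in>{..<d}. card {p \<in> U \<times> U. bit (fst p) i \<noteq> bit (snd p) i} = 2 * (card (A i) * card (B i))"
    proof
      fix i
      have "{p \<in> U \<times> U. bit (fst p) i \<noteq> bit (snd p) i} = A i \<times> B i \<union> B i \<times> A i"
        by (auto simp: A_def B_def)
      moreover have "card (A i \<times> B i \<union> B i \<times> A i) = card (A i \<times> B i) + card (B i \<times> A i)"
        using finAB by (intro card_Un_disjoint) (auto simp: A_def B_def)
      ultimately show "card {p \<in> U \<times> U. bit (fst p) i \<noteq> bit (snd p) i} = 2 * (card (A i) * card (B i))"
        by (simp add: card_cartesian_product)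
    qed
  qed (use finU in auto)
  finally have "(\<Sum>x\<in>U. \<Sum>y\<in>U. hamming d x y) = 2 * (\<Sum>i<d. card (A i) * card (B i))"
    by (simp add: sum.cartesian_product' sum_distrib_left)
  then have dist: "(\<Sum>x\<in>U. \<Sum>y\<in>U. real (hamming d x y)) = 2 * (\<Sum>i<d. real (card (A i)) * real (card (B i)))"
    by (simp flip: of_nat_sum of_nat_mult)
  \<comment> \<open>At most half of \<open>U\<close> lies in the ball of radius \<open>r\<close>
    about \<open>x\<close>; each other vertex is at distance at least \<open>r + 1\<close>.\<close>
  have far: "u / 2 * (real r + 1) \<le> (\<Sum>y\<in>U. real (hamming d x y))" if "x \<in> U" for x
  proof -
    let ?N = "{y \<in> U. hamming d x y \<le> r}"
    have x: "x < 2 ^ d" using that U W by auto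
    have "card ?N \<le> card {y. y < 2 ^ d \<and> hamming d x y \<le> r}"
      using U W by (intro card_mono) auto
    also have "\<dots> \<le> (d + 1) ^ r" by (rule card_hamming_ball[OF x])
    finally have "2 * card ?N \<le> card U" using r by linarith
    moreover have "card (U - ?N) = card U - card ?N" using finU by (intro card_Diff_subset) auto
    moreover have "card ?N \<le> card U" using finU by (intro card_mono) auto
    ultimately have "u / 2 \<le> real (card (U - ?N))" unfolding u_def by linarith
    then have "u / 2 * (real r + 1) \<le> (\<Sum>y\<in>U - ?N. real r + 1)"
      by (simp add: mult_right_mono)
    also have "\<dots> \<le> (\<Sum>y\<in>U - ?N. real (hamming d x y))" by (rule sum_mono) auto
    also have "\<dots> \<le> (\<Sum>y\<in>U. real (hamming d x y))" using finU by (intro sum_mono2) auto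
    finally show ?thesis .
  qed
  have "u * (u / 2 * (real r + 1)) = (\<Sum>x\<in>U. u / 2 * (real r + 1))" by (simp add: u_def)
  also have "\<dots> \<le> (\<Sum>x\<in>U. \<Sum>y\<in>U. real (hamming d x y))" by (rule sum_mono) (rule far)
  finally have tot: "u * u * (real r + 1) / 4 \<le> (\<Sum>i<d. real (card (A i)) * real (card (B i)))"
    unfolding dist by (simp add: field_simps)
  \<comment> \<open>One coordinate that is not constant on \<open>U\<close> suffices to make the
    summed inequality strict.\<close>
  have "\<exists>i<d. A i \<noteq> {} \<and> B i \<noteq> {}"
  proof (rule ccontr)
    assume "\<not> ?thesis"
    then have "(\<Sum>i<d. real (card (A i)) * real (card (B i))) = 0" by (intro sum.neutral) auto
    then show False using tot u by (smt (verit) divide_pos_pos mult_pos_pos of_nat_0_le_iff)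
  qed
  then obtain i0 where i0: "i0 < d" "A i0 \<noteq> {}" "B i0 \<noteq> {}" by blast
  have "\<alpha> * (u * u * (real r + 1) / 4) \<le> \<alpha> * (\<Sum>i<d. real (card (A i)) * real (card (B i)))"
    by (rule mult_left_mono[OF tot \<alpha>])
  also have "\<dots> < u * (\<Sum>i<d. real (card (edge_cut F (A i) (B i))))"
    unfolding sum_distrib_left
    by (rule sum_strict_mono_ex1) (use cut_ge cut_gt i0 in auto)
  also have "\<dots> \<le> u * real (card {e \<in> F. e \<subseteq> U})" using m u by simp
  also have "\<dots> \<le> u * (D * u / 2)"
    using card_induced_edges_le[OF G U(1) deg] u by (simp add: u_def)
  finally have "\<alpha> * (u * u * (real r + 1) / 4) < u * (D * u / 2)" .
  \<comment> \<open>The value of \<alpha> is the one at which both bounds coincide, so strictness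
    gives the contradiction.\<close>
  moreover have "\<alpha> * (u * u * (real r + 1) / 4) = u * (D * u / 2)" by (simp add: \<alpha>_def field_simps)
  ultimately show False by simp
qed

section \<open>Sparse cuts in graphs of large girth\<close>

text \<open>\<open>p\<close> is the parent map and \<open>lev\<close> the depth. The root is its own
  parent, so that iterates of \<open>p\<close> never leave \<open>B\<close>. Two upward paths of
  length at most \<open>R\<close> and one edge form a closed walk of length at most
  \<open>2 * R + 1\<close>, which explains the bound on cycles.\<close>

locale rooted_tree =
  fixes F :: "'a set set" and B :: "'a set" and v :: 'a
    and lev :: "'a \<Rightarrow> nat" and p :: "'a \<Rightarrow> 'a" and R :: nat
  assumes finB: "finite B" and root: "v \<in> B" "lev v = 0" "p v = v"
    and parent: "\<And>x. x \<in> B \<Longrightarrow> x \<noteq> v \<Longrightarrow> p x \<in> B \<and> lev x = Suc (lev (p x)) \<and> {p x, x} \<in> F"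
    and lev_le: "\<And>x. x \<in> B \<Longrightarrow> lev x \<le> R"
    and no_short_cycle: "\<And>xs. is_cycle F xs \<Longrightarrow> 2 * R + 1 < length xs"
begin

lemma pow_in: "x \<in> B \<Longrightarrow> (p ^^ i) x \<in> B"
proof (induction i)
  case (Suc i)
  then show ?case using parent[of "(p ^^ i) x"] root by (cases "(p ^^ i) x = v") auto
qed simp

text \<open>Truncated subtraction is right here because the iteration stays at the root once it has
  arrived there.\<close>

lemma lev_pow: "x \<in> B \<Longrightarrow> lev ((p ^^ i) x) = lev x - i"
proof (induction i)
  case (Suc i)
  then show ?case using parent[OF pow_in[of x i]] root by (cases "(p ^^ i) x = v") auto
qed simp

lemma lev_0: "x \<in> B \<Longrightarrow> lev x = 0 \<Longrightarrow> x = v"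
  using parent by fastforce

lemma pow_lev: "x \<in> B \<Longrightarrow> (p ^^ lev x) x = v"
  by (intro lev_0 pow_in) (simp_all add: lev_pow)

lemma pow_edge: "x \<in> B \<Longrightarrow> i < lev x \<Longrightarrow> {(p ^^ Suc i) x, (p ^^ i) x} \<in> F"
  using parent[OF pow_in[of x i]] lev_pow[of x i] root by (cases "(p ^^ i) x = v") auto

text \<open>Otherwise the edge closes a cycle through the first common ancestor of its ends.\<close>

lemma edge_is_parent:
  assumes xy: "x \<in> B" "y \<in> B" "{x, y} \<in> F" "x \<noteq> y"
  shows "p x = y \<or> p y = x"
proof (rule ccontr)
  assume no: "\<not> ?thesis"
  \<comment> \<open>\<open>s\<close> is the total length of two upward paths, from \<open>x\<close>
    and from \<open>y\<close>, that meet. Minimality of \<open>a + b\<close> keeps the two paths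
    disjoint before they meet.\<close>
  let ?P = "\<lambda>s. \<exists>a b. s = a + b \<and> a \<le> lev x \<and> b \<le> lev y \<and> (p ^^ a) x = (p ^^ b) y"
  have "?P (lev x + lev y)" using pow_lev xy by auto
  then have "?P (LEAST s. ?P s)" by (rule LeastI)
  then obtain a b where ab: "(LEAST s. ?P s) = a + b" "a \<le> lev x" "b \<le> lev y" "(p ^^ a) x = (p ^^ b) y"
    by blast
  have min: "a + b \<le> i + j" if "i \<le> lev x" "j \<le> lev y" "(p ^^ i) x = (p ^^ j) y" for i j
    unfolding ab(1)[symmetric] by (rule Least_le) (use that in blast)
  have ab2: "2 \<le> a + b"
  proof (rule ccontr)
    assume "\<not> 2 \<le> a + b"
    then consider "a = 0" "b = 0" | "a = 1" "b = 0" | "a = 0" "b = 1" by linarith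
    then show False using ab(4) xy no by cases auto
  qed
  \<comment> \<open>The cycle climbs from \<open>x\<close> to the meeting point at index
    \<open>a\<close> and descends to \<open>y\<close> at index \<open>a + b\<close>; the edge
    between \<open>y\<close> and \<open>x\<close> closes it.\<close>
  define h where "h i = (if i \<le> a then (p ^^ i) x else (p ^^ (a + b - i)) y)" for i
  have h2: "h i = (p ^^ (a + b - i)) y" if "a \<le> i" for i
    using that ab(4) by (cases "i = a") (auto simp: h_def)
  have inj: "i = j" if ij: "i < a + b + 1" "j < a + b + 1" "h i = h j" "i \<le> j" for i j
  proof -
    consider "j \<le> a" | "i \<le> a" "a < j" | "a < i" using ij by linarith
    then show ?thesis
    proof cases
      case 1
      then have "(p ^^ i) x = (p ^^ j) x" using ij by (auto simp: h_def)
      then have "lev x - i = lev x - j" using lev_pow xy by metis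
      then show ?thesis using 1 ij ab by linarith
    next
      case 2
      then have "(p ^^ i) x = (p ^^ (a + b - j)) y" using ij by (auto simp: h_def)
      then have "a + b \<le> i + (a + b - j)" using 2 ij ab by (intro min) auto
      then show ?thesis using 2 ij by linarith
    next
      case 3
      then have "(p ^^ (a + b - i)) y = (p ^^ (a + b - j)) y" using ij by (auto simp: h_def)
      then have "lev y - (a + b - i) = lev y - (a + b - j)" using lev_pow xy by metis
      then show ?thesis using 3 ij ab by linarith
    qed
  qed
  have "is_cycle F (map h [0..<a + b + 1])"
    unfolding is_cycle_def
  proof (intro conjI allI impI)
    have "inj_on h {0..<a + b + 1}"
    proof (rule inj_onI)
      fix i j assume "i \<in> {0..<a + b + 1}" "j \<in> {0..<a + b + 1}" "h i = h j"
      then show "i = j" using inj[of i j] inj[of j i] by (cases "i \<le> j") auto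
    qed
    then show "distinct (map h [0..<a + b + 1])" by (simp only: distinct_map distinct_upt set_upt simp_thms)
    fix i assume i: "i < length (map h [0..<a + b + 1])"
    show "{map h [0..<a + b + 1] ! i, map h [0..<a + b + 1] ! (Suc i mod length (map h [0..<a + b + 1]))} \<in> F"
    proof (cases "i = a + b")
      case True
      then show ?thesis using h2[of "a + b"] xy by (simp add: h_def insert_commute del: upt_Suc)
    next
      case False
      then have "{h i, h (Suc i)} \<in> F"
      proof (cases "i < a")
        case True
        then show ?thesis using pow_edge[of x i] ab xy by (auto simp: h_def insert_commute)
      next
        case F: False
        then have "h i = (p ^^ Suc (a + b - Suc i)) y" "h (Suc i) = (p ^^ (a + b - Suc i)) y"
          using False i by (auto simp: h2 Suc_diff_Suc simp del: funpow.simps)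
        then show ?thesis using pow_edge[of y "a + b - Suc i"] ab xy False F i by auto
      qed
      then show ?thesis using False i by (simp del: upt_Suc)
    qed
  qed (use ab2 in auto)
  then have "2 * R + 1 < a + b + 1" using no_short_cycle by fastforce
  then show False using ab lev_le[of x] lev_le[of y] xy by linarith
qed

definition sub :: "'a \<Rightarrow> 'a set" where
  "sub w = {x \<in> B. \<exists>j. (p ^^ j) x = w}"

definition children :: "'a \<Rightarrow> 'a set" where
  "children w = {c \<in> B. c \<noteq> v \<and> p c = w}"

lemma finite_sub: "finite (sub w)" and finite_children: "finite (children w)"
  using finB by (auto simp: sub_def children_def)

lemma sub_root: "sub v = B"
  using pow_lev by (auto simp: sub_def)

lemma sub_eq:
  assumes "w \<in> B"
  shows "sub w = insert w (\<Union>c\<in>children w. sub c)"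
proof (intro equalityI subsetI)
  fix x assume x: "x \<in> sub w"
  \<comment> \<open>With the least \<open>j\<close> the vertex before \<open>w\<close> on the path
    differs from \<open>w\<close>. This matters at the root, which is its own parent but not its own
    child.\<close>
  define j where "j = (LEAST j. (p ^^ j) x = w)"
  have j: "(p ^^ j) x = w" unfolding j_def using x by (auto simp: sub_def intro: LeastI)
  show "x \<in> insert w (\<Union>c\<in>children w. sub c)"
  proof (cases j)
    case 0
    then show ?thesis using j by simp
  next
    case (Suc i)
    then have i: "(p ^^ i) x \<noteq> w" using not_less_Least[of i "\<lambda>j. (p ^^ j) x = w"] by (simp add: j_def)
    have "p ((p ^^ i) x) = w" using j Suc by simp
    moreover from this have "(p ^^ i) x \<noteq> v" using i root by auto
    ultimately have "(p ^^ i) x \<in> children w" using x pow_in[of x i] by (auto simp: children_def sub_def)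
    then show ?thesis using x by (auto simp: sub_def)
  qed
next
  fix x assume "x \<in> insert w (\<Union>c\<in>children w. sub c)"
  then consider "x = w" | c j where "c \<in> children w" "x \<in> B" "(p ^^ j) x = c" by (auto simp: sub_def)
  then show "x \<in> sub w"
  proof cases
    case 1
    then show ?thesis using assms by (auto simp: sub_def intro: exI[of _ 0])
  next
    case 2
    then have "(p ^^ Suc j) x = w" by (simp add: children_def)
    then show ?thesis using 2 unfolding sub_def by blast
  qed
qed

lemma card_sub_child:
  assumes "c \<in> children w" "w \<in> B"
  shows "card (sub c) < card (sub w)"
proof (rule psubset_card_mono[OF finite_sub])
  have "w \<notin> sub c"
  proof
    assume "w \<in> sub c"
    then obtain j where "(p ^^ j) w = c" by (auto simp: sub_def)
    then have "lev c \<le> lev w" using lev_pow[OF assms(2), of j] by auto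
    moreover have "lev c = Suc (lev w)" using assms parent[of c] by (auto simp: children_def)
    ultimately show False by simp
  qed
  then show "sub c \<subset> sub w" using sub_eq[OF assms(2)] assms(1) by blast
qed

lemma card_children_le:
  assumes "finite F" "w \<in> B"
  shows "card (children w) \<le> degree F w"
  unfolding degree_def
proof (rule card_inj_on_le[where f = "\<lambda>c. {w, c}"])
  show "inj_on (\<lambda>c. {w, c}) (children w)" by (rule inj_onI) (auto simp: doubleton_eq_iff)
  show "(\<lambda>c. {w, c}) ` children w \<subseteq> {e \<in> F. w \<in> e}" using parent by (auto simp: children_def)
qed (use assms in auto)

text \<open>The witness is the largest child subtree of a vertex whose subtree is minimal among those
  containing at least half of the tree.\<close>

lemma balanced_subtree:
  assumes finF: "finite F" and F: "\<And>e. e \<in> F \<Longrightarrow> card e = 2"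
    and deg: "\<And>w. w \<in> B \<Longrightarrow> degree F w \<le> D" and B3: "3 \<le> card B"
  shows "\<exists>Y\<subseteq>B. 2 * card Y < card B \<and> card B \<le> 2 + 2 * D * card Y \<and> card (edge_cut F Y (B - Y)) \<le> 1"
proof -
  define w where "w = arg_min_on (\<lambda>w. card (sub w)) {w \<in> B. card B \<le> 2 * card (sub w)}"
  have ne: "{w \<in> B. card B \<le> 2 * card (sub w)} \<noteq> {}" using root sub_root by auto
  have w: "w \<in> B" "card B \<le> 2 * card (sub w)"
    using arg_min_if_finite(1)[OF _ ne, of "\<lambda>w. card (sub w)"] finB by (auto simp: w_def)
  have small: "2 * card (sub c) < card B" if c: "c \<in> children w" for c
  proof (rule ccontr)
    assume "\<not> ?thesis"
    then have "c \<in> {w \<in> B. card B \<le> 2 * card (sub w)}" using c by (auto simp: children_def)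
    then have "card (sub w) \<le> card (sub c)"
      unfolding w_def by (intro arg_min_least[OF _ ne]) (use finB in auto)
    then show False using card_sub_child[OF c w(1)] by simp
  qed
  \<comment> \<open>Pigeonhole over at most \<open>D\<close> children: their subtrees together with
    \<open>w\<close> contain at least half of the tree.\<close>
  have "\<exists>c\<in>children w. card B \<le> 2 + 2 * D * card (sub c)"
  proof (rule ccontr)
    assume no: "\<not> ?thesis"
    have "card (sub w) \<le> 1 + card (\<Union>c\<in>children w. sub c)"
      unfolding sub_eq[OF w(1)] by (simp add: card_insert_le_m1 card_insert_if finite_children finite_sub)
    also have "\<dots> \<le> 1 + (\<Sum>c\<in>children w. card (sub c))"
      by (simp add: card_UN_le finite_children)
    finally have 1: "card B \<le> 2 + 2 * (\<Sum>c\<in>children w. card (sub c))" using w(2) by simp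
    then have ch: "children w \<noteq> {}" using B3 by auto
    have "D * (2 * (\<Sum>c\<in>children w. card (sub c))) = (\<Sum>c\<in>children w. 2 * D * card (sub c))"
      by (simp add: sum_distrib_left algebra_simps)
    also have "\<dots> < (\<Sum>c\<in>children w. card B - 2)"
      by (rule sum_strict_mono[OF finite_children ch]) (use no in auto)
    also have "\<dots> \<le> D * (card B - 2)"
      using card_children_le[OF finF w(1)] deg[OF w(1)] by simp
    also have "\<dots> \<le> D * (2 * (\<Sum>c\<in>children w. card (sub c)))" using 1 by (intro mult_left_mono) auto
    finally show False by simp
  qed
  then obtain c where c: "c \<in> children w" "card B \<le> 2 + 2 * D * card (sub c)" by blast
  \<comment> \<open>Every edge inside \<open>B\<close> joins a vertex to its parent, and such an
    edge can leave the subtree only upwards from \<open>c\<close>.\<close>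
  have "edge_cut F (sub c) (B - sub c) \<subseteq> {{c, p c}}"
  proof
    fix e assume "e \<in> edge_cut F (sub c) (B - sub c)"
    then obtain x y where e: "e = {x, y}" "e \<in> F" "x \<in> sub c" "y \<in> B" "y \<notin> sub c" by (auto simp: edge_cut_def)
    have x: "x \<in> B" using e by (auto simp: sub_def)
    obtain j where j: "(p ^^ j) x = c" using e by (auto simp: sub_def)
    have "p y \<noteq> x"
    proof
      assume "p y = x"
      then have "(p ^^ Suc j) y = c" using j by (simp only: funpow_Suc_right comp_apply)
      then show False using e(4,5) unfolding sub_def by blast
    qed
    then have px: "p x = y" using edge_is_parent[OF x e(4)] e by auto
    have "j = 0"
    proof (rule ccontr)
      assume "j \<noteq> 0"
      then obtain i where "j = Suc i" by (cases j) auto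
      then have "(p ^^ i) y = c" using j px by (simp only: funpow_Suc_right comp_apply)
      then show False using e by (auto simp: sub_def)
    qed
    then show "e \<in> {{c, p c}}" using j px e by simp
  qed
  then have "card (edge_cut F (sub c) (B - sub c)) \<le> 1"
    using card_mono[of "{{c, p c}}" "edge_cut F (sub c) (B - sub c)"] by simp
  then show ?thesis using c small[OF c(1)] by (intro exI[of _ "sub c"]) (auto simp: sub_def)
qed

end

section \<open>Balls and breadth-first trees\<close>

fun ball :: "'a set set \<Rightarrow> 'a \<Rightarrow> nat \<Rightarrow> 'a set" where
  "ball F v 0 = {v}"
| "ball F v (Suc j) = ball F v j \<union> {y. \<exists>x\<in>ball F v j. {x, y} \<in> F}"

lemma ball_mono: "i \<le> j \<Longrightarrow> ball F v i \<subseteq> ball F v j"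
  by (rule lift_Suc_mono_le[of "ball F v"]) auto

lemma root_in_ball: "v \<in> ball F v j"
  using ball_mono[of 0 j F v] by auto

lemma ball_subset:
  assumes "simple_graph U F" "v \<in> U"
  shows "ball F v j \<subseteq> U"
proof (induction j)
  case (Suc j)
  then show ?case using assms by (fastforce simp: simple_graph_def)
qed (use assms in simp)

text \<open>The breadth-first tree: \<open>lev x\<close> is the first radius at which
  \<open>x\<close> is reached, and the parent is a chosen neighbour in the preceding ball.\<close>

lemma ball_rooted_tree:
  assumes G: "simple_graph U F" "v \<in> U" and cyc: "\<And>xs. is_cycle F xs \<Longrightarrow> 2 * j + 1 < length xs"
  shows "\<exists>lev p. rooted_tree F (ball F v j) v lev p j"
proof -
  define lev where "lev x = (LEAST i. x \<in> ball F v i)" for x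
  define p where "p x = (if x = v then v else SOME y. y \<in> ball F v (lev x - 1) \<and> {y, x} \<in> F)" for x
  have lev_le: "lev x \<le> i" if "x \<in> ball F v i" for x i
    unfolding lev_def using that by (rule Least_le)
  have p: "p x \<in> ball F v j \<and> lev x = Suc (lev (p x)) \<and> {p x, x} \<in> F" if x: "x \<in> ball F v j" "x \<noteq> v" for x
  proof -
    have in_lev: "x \<in> ball F v (lev x)" unfolding lev_def using x(1) by (rule LeastI)
    then obtain i where i: "lev x = Suc i" using x(2) by (cases "lev x") auto
    have "x \<notin> ball F v i" using lev_le i by fastforce
    then have "\<exists>y. y \<in> ball F v i \<and> {y, x} \<in> F" using in_lev i by auto
    then have px: "p x \<in> ball F v i" "{p x, x} \<in> F"
      unfolding p_def using x(2) i someI_ex[of "\<lambda>y. y \<in> ball F v i \<and> {y, x} \<in> F"] by auto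
    \<comment> \<open>A parent at a smaller level would place \<open>x\<close> in an earlier
      ball.\<close>
    have "i \<le> lev (p x)"
    proof -
      have "p x \<in> ball F v (lev (p x))" unfolding lev_def using px(1) by (rule LeastI)
      then have "x \<in> ball F v (Suc (lev (p x)))" using px(2) by auto
      then show ?thesis using lev_le i by fastforce
    qed
    moreover have "lev (p x) \<le> i" by (rule lev_le[OF px(1)])
    moreover have "p x \<in> ball F v j" using px(1) ball_mono[of i j F v] lev_le[OF x(1)] i by auto
    ultimately show ?thesis using i px by simp
  qed
  have "rooted_tree F (ball F v j) v lev p j"
  proof
    show "finite (ball F v j)"
      using ball_subset[OF G] G(1) finite_subset unfolding simple_graph_def by metis
    show "lev v = 0" using lev_le[of v 0] by simp
  qed (use p cyc lev_le root_in_ball in \<open>auto simp: p_def\<close>)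
  then show ?thesis by blast
qed

text \<open>Every edge leaving the ball has its outer end in the next sphere, each vertex of which
  carries at most \<open>D\<close> edges.\<close>

lemma card_ball_cut_le:
  assumes G: "simple_graph U F" "v \<in> U" and deg: "\<And>w. w \<in> U \<Longrightarrow> degree F w \<le> D"
  shows "card (edge_cut F (ball F v j) (U - ball F v j)) \<le> D * (card (ball F v (Suc j)) - card (ball F v j))"
proof -
  let ?S = "ball F v (Suc j) - ball F v j"
  have fin: "finite U" "finite F" using G simple_graph_finite_edges by (auto simp: simple_graph_def)
  have sub: "ball F v i \<subseteq> U" for i using G by (rule ball_subset)
  have finb: "finite (ball F v i)" for i using sub fin finite_subset by metis
  have "edge_cut F (ball F v j) (U - ball F v j) \<subseteq> (\<Union>z\<in>?S. {e \<in> F. z \<in> e})"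
    by (auto simp: edge_cut_def)
  then have "card (edge_cut F (ball F v j) (U - ball F v j)) \<le> card (\<Union>z\<in>?S. {e \<in> F. z \<in> e})"
    using fin finb by (intro card_mono) (auto simp del: ball.simps)
  also have "\<dots> \<le> (\<Sum>z\<in>?S. card {e \<in> F. z \<in> e})" using finb by (intro card_UN_le) (auto simp del: ball.simps)
  also have "\<dots> \<le> (\<Sum>z\<in>?S. D)"
    by (rule sum_mono) (use deg sub[of "Suc j"] in \<open>auto simp: degree_def simp del: ball.simps\<close>)
  also have "\<dots> = D * (card (ball F v (Suc j)) - card (ball F v j))"
    using finb[of j] ball_mono[of j "Suc j" F v] by (simp add: card_Diff_subset mult.commute del: ball.simps)
  finally show ?thesis .
qed

text \<open>Grow a ball until its boundary is small. If the ball has more than half of the vertices, it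
  is a tree by the girth condition, and one of its subtrees is taken instead.\<close>

lemma high_girth_sparse_cut:
  fixes y :: real
  assumes G: "simple_graph U F" and deg: "\<And>w. w \<in> U \<Longrightarrow> degree F w \<le> D"
    and cyc: "\<And>xs. is_cycle F xs \<Longrightarrow> 2 * R + 1 < length xs"
    and y: "0 \<le> y" "real (card U) < (1 + y) ^ R" and U8: "8 \<le> card U"
  shows "\<exists>X\<subseteq>U. X \<noteq> {} \<and> 2 * card X \<le> card U \<and>
    real (card (edge_cut F X (U - X))) \<le> (8 * real D / real (card U) + 4 * (real D)\<^sup>2 * y) * real (card X)"
proof -
  have fin: "finite U" "finite F" using G simple_graph_finite_edges by (auto simp: simple_graph_def)
  obtain v where v: "v \<in> U" using U8 by fastforce
  have sub: "ball F v i \<subseteq> U" for i using G v by (rule ball_subset)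
  have finb: "finite (ball F v i)" for i using sub fin finite_subset by metis
  \<comment> \<open>Otherwise the balls grow by the factor \<open>1 + y\<close> in each of
    \<open>R\<close> steps and outgrow \<open>U\<close>.\<close>
  have "\<exists>j<R. real (card (ball F v (Suc j))) \<le> (1 + y) * real (card (ball F v j))"
  proof (rule ccontr)
    assume no: "\<not> ?thesis"
    have "i \<le> R \<Longrightarrow> (1 + y) ^ i \<le> real (card (ball F v i))" for i
    proof (induction i)
      case (Suc i)
      then have "(1 + y) * (1 + y) ^ i \<le> (1 + y) * real (card (ball F v i))"
        using y by (intro mult_left_mono) auto
      also have "\<dots> \<le> real (card (ball F v (Suc i)))" using no Suc.prems by (meson Suc_le_lessD linear)
      finally show ?case by simp
    qed simp
    from this[of R] have "(1 + y) ^ R \<le> real (card U)"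
      using card_mono[OF fin(1) sub[of R]] by (simp del: ball.simps)
    then show False using y by simp
  qed
  then obtain j where j: "j < R" "real (card (ball F v (Suc j))) \<le> (1 + y) * real (card (ball F v j))" by blast
  let ?B = "ball F v j"
  have b1: "card ?B \<ge> 1" using root_in_ball[of v F j] finb[of j] by (metis One_nat_def Suc_leI card_gt_0_iff empty_iff)
  have mono: "card ?B \<le> card (ball F v (Suc j))"
    using finb ball_mono[of j "Suc j" F v] by (intro card_mono) (auto simp del: ball.simps)
  have "real (card (edge_cut F ?B (U - ?B))) \<le> real (D * (card (ball F v (Suc j)) - card ?B))"
    using card_ball_cut_le[OF G v deg] of_nat_mono by blast
  also have "\<dots> = real D * (real (card (ball F v (Suc j))) - real (card ?B))" using mono by (simp add: of_nat_diff del: ball.simps)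
  also have "\<dots> \<le> real D * (y * real (card ?B))" using j by (intro mult_left_mono) (auto simp: algebra_simps simp del: ball.simps)
  finally have cutB: "real (card (edge_cut F ?B (U - ?B))) \<le> real D * (y * real (card ?B))" .
  show ?thesis
  proof (cases "2 * card ?B \<le> card U")
    case True
    have "real D \<le> 4 * real D ^ 2" by (cases D) (auto simp: power2_eq_square algebra_simps)
    then have "real D * (y * real (card ?B)) \<le> 4 * real D ^ 2 * (y * card ?B)" using y by (intro mult_right_mono) auto
    then have "real (card (edge_cut F ?B (U - ?B))) \<le> 4 * real D ^ 2 * y * real (card ?B)"
      using cutB by (simp add: mult.assoc)
    also have "\<dots> \<le> (8 * real D / real (card U) + 4 * (real D)\<^sup>2 * y) * real (card ?B)" by (simp add: algebra_simps)
    finally show ?thesis using True sub root_in_ball[of v F j] by (intro exI[of _ ?B]) auto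
  next
    case False
    obtain lev p where "rooted_tree F ?B v lev p j"
      using ball_rooted_tree[OF G v, of j] cyc j by fastforce
    then interpret rooted_tree F ?B v lev p j .
    obtain Y where Y: "Y \<subseteq> ?B" "2 * card Y < card ?B" "card ?B \<le> 2 + 2 * D * card Y"
      "card (edge_cut F Y (?B - Y)) \<le> 1"
      using balanced_subtree[OF fin(2), of D] deg sub G False U8 by (auto simp: simple_graph_def)
    define b where "b = real (card ?B)"
    have b4: "b > 4" "b \<le> card U" "card U \<le> 2 * b"
      using False U8 card_mono[OF fin(1) sub[of j]] by (auto simp: b_def)
    have "b \<le> 2 + 2 * real D * real (card Y)" using Y(3) unfolding b_def by (metis of_nat_mono of_nat_add of_nat_mult of_nat_numeral)
    then have bY: "b \<le> 4 * real D * real (card Y)" using b4 by linarith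
    \<comment> \<open>An edge leaving the subtree stays in the ball, which happens at most once, or
      belongs to the boundary of the ball.\<close>
    have "edge_cut F Y (U - Y) \<subseteq> edge_cut F Y (?B - Y) \<union> edge_cut F ?B (U - ?B)"
      using Y(1) unfolding edge_cut_def by blast
    then have "card (edge_cut F Y (U - Y)) \<le> card (edge_cut F Y (?B - Y) \<union> edge_cut F ?B (U - ?B))"
      using finite_edge_cut[OF fin(2)] by (intro card_mono) auto
    also have "\<dots> \<le> card (edge_cut F Y (?B - Y)) + card (edge_cut F ?B (U - ?B))" by (rule card_Un_le)
    finally have "card (edge_cut F Y (U - Y)) \<le> card (edge_cut F Y (?B - Y)) + card (edge_cut F ?B (U - ?B))" .
    then have "real (card (edge_cut F Y (U - Y))) \<le> 1 + real D * (y * b)"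
      using Y(4) cutB by (simp add: b_def)
    \<comment> \<open>The ball has more than half of \<open>U\<close> and at most
      \<open>4 * D * card Y\<close> vertices, so both the single tree edge and the boundary of the
      ball are charged to \<open>Y\<close>.\<close>
    also have "\<dots> \<le> 8 * real D / real (card U) * real (card Y) + real D * (y * (4 * real D * real (card Y)))"
    proof (rule add_mono)
      have "real (card U) \<le> 8 * real D * real (card Y)" using bY b4 by simp
      then show "1 \<le> 8 * real D / real (card U) * real (card Y)" using U8 by (simp add: field_simps)
      show "real D * (y * b) \<le> real D * (y * (4 * real D * real (card Y)))"
        using bY y by (intro mult_left_mono) auto
    qed
    also have "\<dots> = (8 * real D / real (card U) + 4 * (real D)\<^sup>2 * y) * real (card Y)" by (simp add: algebra_simps power2_eq_square)
    finally have "real (card (edge_cut F Y (U - Y))) \<le> (8 * real D / real (card U) + 4 * (real D)\<^sup>2 * y) * real (card Y)" .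
    moreover have "Y \<noteq> {}" using bY b4 by auto
    moreover have "2 * card Y \<le> card U" using Y(2) card_mono[OF fin(1) sub[of j]] by linarith
    ultimately show ?thesis using Y(1) sub by (intro exI[of _ Y]) auto
  qed
qed

section \<open>Random subgraphs\<close>

text \<open>The expectation of \<open>f S\<close> when \<open>S\<close> contains each element of
  \<open>E\<close> independently with probability \<open>p\<close>, written as a finite weighted
  sum.\<close>

definition random_mean :: "real \<Rightarrow> 'b set \<Rightarrow> ('b set \<Rightarrow> real) \<Rightarrow> real" where
  "random_mean p E f = (\<Sum>S\<in>Pow E. p ^ card S * (1 - p) ^ card (E - S) * f S)"

text \<open>Expand the product over \<open>E\<close> of \<open>p + (1 - p)\<close>, with
  \<open>1 - p\<close> replaced by 0 on \<open>T\<close>: exactly the terms of sets \<open>S\<close>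
  containing \<open>T\<close> survive.\<close>

lemma random_mean_subset:
  assumes "finite E" "T \<subseteq> E"
  shows "random_mean p E (\<lambda>S. of_bool (T \<subseteq> S)) = p ^ card T"
proof -
  have "(\<Prod>e\<in>E. p + (if e \<in> T then 0 else 1 - p)) =
      (\<Sum>S\<in>Pow E. (\<Prod>e\<in>S. p) * (\<Prod>e\<in>E - S. if e \<in> T then 0 else 1 - p))"
    by (rule prod_add[OF assms(1)])
  also have "\<dots> = random_mean p E (\<lambda>S. of_bool (T \<subseteq> S))"
    unfolding random_mean_def
  proof (rule sum.cong[OF refl])
    fix S assume "S \<in> Pow E"
    show "(\<Prod>e\<in>S. p) * (\<Prod>e\<in>E - S. if e \<in> T then 0 else 1 - p) =
        p ^ card S * (1 - p) ^ card (E - S) * of_bool (T \<subseteq> S)"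
    proof (cases "T \<subseteq> S")
      case True
      then have "(\<Prod>e\<in>E - S. if e \<in> T then 0 else 1 - p) = (\<Prod>e\<in>E - S. 1 - p)"
        by (intro prod.cong) auto
      then show ?thesis using True by simp
    next
      case False
      then have "\<exists>e\<in>E - S. (if e \<in> T then 0 else 1 - p) = 0" using assms(2) by auto
      then have "(\<Prod>e\<in>E - S. if e \<in> T then 0 else 1 - p) = 0"
        using assms(1) by (intro prod_zero) auto
      then show ?thesis using False by simp
    qed
  qed
  also have "(\<Prod>e\<in>E. p + (if e \<in> T then 0 else 1 - p)) = (\<Prod>e\<in>E. if e \<in> T then p else 1)"
    by (intro prod.cong) auto
  also have "\<dots> = p ^ card T"
    using assms by (simp add: prod.If_cases Int_absorb1)
  finally show ?thesis by simp
qed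

lemma random_mean_const: "finite E \<Longrightarrow> random_mean p E (\<lambda>S. c) = c"
  using random_mean_subset[of E "{}" p] by (simp add: random_mean_def flip: sum_distrib_right)

lemma random_mean_diff: "random_mean p E (\<lambda>S. f S - g S) = random_mean p E f - random_mean p E g"
  by (simp add: random_mean_def right_diff_distrib sum_subtractf)

lemma random_mean_add: "random_mean p E (\<lambda>S. f S + g S) = random_mean p E f + random_mean p E g"
  by (simp add: random_mean_def distrib_left sum.distrib)

lemma random_mean_mult: "random_mean p E (\<lambda>S. c * f S) = c * random_mean p E f"
  by (simp add: random_mean_def sum_distrib_left algebra_simps)

lemma random_mean_sum: "random_mean p E (\<lambda>S. \<Sum>i\<in>I. f i S) = (\<Sum>i\<in>I. random_mean p E (f i))"
  by (simp add: random_mean_def sum_distrib_left sum.swap[of _ I])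

lemma random_mean_mono:
  assumes "0 \<le> p" "p \<le> 1" "\<And>S. S \<subseteq> E \<Longrightarrow> f S \<le> g S"
  shows "random_mean p E f \<le> random_mean p E g"
  unfolding random_mean_def using assms by (intro sum_mono mult_left_mono) auto

lemma random_mean_cong:
  assumes "\<And>S. S \<subseteq> E \<Longrightarrow> f S = g S"
  shows "random_mean p E f = random_mean p E g"
  unfolding random_mean_def using assms by (intro sum.cong) auto

lemma random_mean_ge_imp_ex:
  assumes "finite E" "0 \<le> p" "p \<le> 1" "c \<le> random_mean p E f"
  shows "\<exists>S\<subseteq>E. c \<le> f S"
proof (rule ccontr)
  assume no: "\<not> ?thesis"
  define m where "m = Max (f ` Pow E)"
  have "m \<in> f ` Pow E" unfolding m_def using assms(1) by (intro Max_in) auto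
  then have "m < c" using no by auto
  have "random_mean p E f \<le> random_mean p E (\<lambda>_. m)"
    using assms by (intro random_mean_mono) (auto simp: m_def)
  then show False using assms \<open>m < c\<close> by (simp add: random_mean_const)
qed

lemma random_mean_card_Int:
  assumes "finite E" "A \<subseteq> E"
  shows "random_mean p E (\<lambda>S. real (card (A \<inter> S))) = p * real (card A)"
proof -
  have fin: "finite A" using assms finite_subset by blast
  have "random_mean p E (\<lambda>S. real (card (A \<inter> S))) = random_mean p E (\<lambda>S. \<Sum>e\<in>A. of_bool ({e} \<subseteq> S))"
    using fin by (simp add: sum_of_bool_eq Int_def)
  also have "\<dots> = (\<Sum>e\<in>A. p ^ card {e})"
    unfolding random_mean_sum using assms by (intro sum.cong random_mean_subset) auto
  finally show ?thesis by simp
qed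

text \<open>The binomial variance. The second moment is a sum over pairs, in which
  \<open>card {e, f}\<close> is 1 on the diagonal and 2 elsewhere.\<close>

lemma random_mean_card_Int_variance:
  assumes "finite E" "A \<subseteq> E" "0 \<le> p"
  shows "random_mean p E (\<lambda>S. (real (card (A \<inter> S)) - p * real (card A))\<^sup>2) \<le> p * real (card A)"
proof -
  have fin: "finite A" using assms finite_subset by blast
  define m where "m = real (card A)"
  have sq: "(real (card (A \<inter> S)))\<^sup>2 = (\<Sum>e\<in>A. \<Sum>f\<in>A. of_bool ({e, f} \<subseteq> S))" for S
  proof -
    have "real (card (A \<inter> S)) = (\<Sum>e\<in>A. of_bool (e \<in> S))"
      using fin by (simp add: sum_of_bool_eq Int_def)
    then show ?thesis by (simp add: power2_eq_square sum_product of_bool_conj)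
  qed
  have "random_mean p E (\<lambda>S. (real (card (A \<inter> S)))\<^sup>2) = (\<Sum>e\<in>A. \<Sum>f\<in>A. p ^ card {e, f})"
    unfolding sq random_mean_sum using assms by (intro sum.cong random_mean_subset) auto
  also have "\<dots> = (\<Sum>e\<in>A. p + (m - 1) * p\<^sup>2)"
  proof (rule sum.cong[OF refl])
    fix e assume e: "e \<in> A"
    have "(\<Sum>f\<in>A. p ^ card {e, f}) = p ^ card {e, e} + (\<Sum>f\<in>A - {e}. p ^ card {e, f})"
      using e fin by (simp add: sum.remove[of A e])
    also have "(\<Sum>f\<in>A - {e}. p ^ card {e, f}) = (\<Sum>f\<in>A - {e}. p\<^sup>2)"
      by (intro sum.cong) (auto simp: card_insert_if power2_eq_square)
    also have "\<dots> = (m - 1) * p\<^sup>2"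
    proof -
      have "1 \<le> card A" using e fin by (metis One_nat_def Suc_leI card_gt_0_iff empty_iff)
      then show ?thesis using e fin by (simp add: m_def of_nat_diff)
    qed
    finally show "(\<Sum>f\<in>A. p ^ card {e, f}) = p + (m - 1) * p\<^sup>2" by simp
  qed
  finally have 2: "random_mean p E (\<lambda>S. (real (card (A \<inter> S)))\<^sup>2) = m * (p + (m - 1) * p\<^sup>2)"
    by (simp add: m_def)
  have "random_mean p E (\<lambda>S. (real (card (A \<inter> S)) - p * m)\<^sup>2) =
      random_mean p E (\<lambda>S. (real (card (A \<inter> S)))\<^sup>2 + (p * m)\<^sup>2 - (2 * p * m) * real (card (A \<inter> S)))"
    by (simp add: power2_diff algebra_simps)
  also have "\<dots> = m * (p + (m - 1) * p\<^sup>2) + (p * m)\<^sup>2 - (2 * p * m) * (p * m)"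
    unfolding random_mean_diff random_mean_add random_mean_mult
    using assms by (simp add: 2 random_mean_const random_mean_card_Int m_def)
  also have "\<dots> = p * m - m * p\<^sup>2" by (simp add: algebra_simps power2_eq_square)
  also have "\<dots> \<le> p * m" by (simp add: m_def)
  finally show ?thesis by (simp add: m_def)
qed

section \<open>Cycles and deletion of edges\<close>

definition cycle_edges :: "'a list \<Rightarrow> 'a set set" where
  "cycle_edges xs = (\<lambda>i. {xs ! i, xs ! (Suc i mod length xs)}) ` {..<length xs}"

lemma is_cycle_iff: "is_cycle E xs \<longleftrightarrow> 3 \<le> length xs \<and> distinct xs \<and> cycle_edges xs \<subseteq> E"
  by (auto simp: is_cycle_def cycle_edges_def)

text \<open>If two positions gave the same edge, it would be traversed in opposite directions, so
  each position would be the cyclic successor of the other, which fails for length at least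
  3.\<close>

lemma card_cycle_edges:
  assumes "3 \<le> length xs" "distinct xs"
  shows "card (cycle_edges xs) = length xs"
proof -
  have "inj_on (\<lambda>i. {xs ! i, xs ! (Suc i mod length xs)}) {..<length xs}"
  proof (rule inj_onI)
    fix i j assume ij: "i \<in> {..<length xs}" "j \<in> {..<length xs}"
      "{xs ! i, xs ! (Suc i mod length xs)} = {xs ! j, xs ! (Suc j mod length xs)}"
    have less: "m mod length xs < length xs" for m
      by (rule mod_less_divisor) (use assms(1) in linarith)
    show "i = j"
    proof (rule ccontr)
      assume "i \<noteq> j"
      then have "xs ! i = xs ! (Suc j mod length xs)" "xs ! j = xs ! (Suc i mod length xs)"
        using ij assms(2) by (auto simp: doubleton_eq_iff nth_eq_iff_index_eq)
      then have "i = Suc j mod length xs" "j = Suc i mod length xs"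
        using ij less assms(2) by (auto simp: nth_eq_iff_index_eq)
      moreover have "Suc m = length xs \<and> Suc m mod length xs = 0 \<or> Suc m mod length xs = Suc m"
        if "m < length xs" for m
        using that by (cases "Suc m = length xs") auto
      ultimately have "Suc j = length xs \<and> i = 0 \<or> i = Suc j" "Suc i = length xs \<and> j = 0 \<or> j = Suc i"
        using ij(1,2) by (metis lessThan_iff)+
      then show False using assms(1) by linarith
    qed
  qed
  then show ?thesis unfolding cycle_edges_def by (simp add: card_image)
qed

text \<open>Cycles are lists, so each one is counted once for every starting point and direction;
  the overcount is harmless in upper bounds.\<close>

definition short_cycles :: "'a set set \<Rightarrow> nat \<Rightarrow> 'a list set" where
  "short_cycles E l = {xs. is_cycle E xs \<and> length xs < l}"

lemma is_cycle_subset_vertices: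
  assumes "simple_graph V E" "is_cycle E xs"
  shows "set xs \<subseteq> V"
proof
  fix x assume "x \<in> set xs"
  then obtain i where "i < length xs" "x = xs ! i" by (auto simp: in_set_conv_nth)
  then have "x \<in> {xs ! i, xs ! (Suc i mod length xs)}" "{xs ! i, xs ! (Suc i mod length xs)} \<in> E"
    using assms(2) by (auto simp: is_cycle_def)
  then show "x \<in> V" using assms(1) unfolding simple_graph_def by blast
qed

lemma finite_short_cycles:
  assumes "simple_graph V E"
  shows "finite (short_cycles E l)"
proof (rule finite_subset)
  show "short_cycles E l \<subseteq> {xs. set xs \<subseteq> V \<and> length xs \<le> l}"
    using is_cycle_subset_vertices[OF assms] by (auto simp: short_cycles_def)
  show "finite {xs. set xs \<subseteq> V \<and> length xs \<le> l}"
    using assms by (intro finite_lists_length_le) (simp add: simple_graph_def)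
qed

text \<open>Delete one edge \<open>c xs\<close> of every short cycle and a set \<open>T v\<close> of
  surplus edges at every vertex; the union bound counts the loss.\<close>

lemma delete_short_cycles_and_excess_degree:
  assumes G: "simple_graph V S"
  shows "\<exists>F\<subseteq>S. (\<forall>v\<in>V. degree F v \<le> M) \<and> (\<forall>xs. is_cycle F xs \<longrightarrow> l \<le> length xs) \<and>
    card S \<le> card F + card (short_cycles S l) + (\<Sum>v\<in>V. degree S v - M)"
proof -
  have fin: "finite V" "finite S" using G simple_graph_finite_edges by (auto simp: simple_graph_def)
  have "\<exists>T\<subseteq>{e \<in> S. v \<in> e}. card T = degree S v - M" for v
    using obtain_subset_with_card_n[of "degree S v - M" "{e \<in> S. v \<in> e}"] unfolding degree_def
    by (metis diff_le_self)
  then obtain T where T: "\<And>v. T v \<subseteq> {e \<in> S. v \<in> e}" "\<And>v. card (T v) = degree S v - M" by metis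
  define c where "c xs = (SOME e. e \<in> cycle_edges xs)" for xs :: "'a list"
  have c: "c xs \<in> cycle_edges xs" if "is_cycle E xs" for E xs
  proof -
    have "cycle_edges xs \<noteq> {}" using that by (auto simp: is_cycle_def cycle_edges_def lessThan_empty_iff)
    then show ?thesis unfolding c_def by (simp add: some_in_eq)
  qed
  define X where "X = c ` short_cycles S l \<union> (\<Union>v\<in>V. T v)"
  define F where "F = S - X"
  have finX: "finite X"
    using finite_short_cycles[OF G] fin T(1) by (auto simp: X_def intro: finite_subset)
  have "card X \<le> card (c ` short_cycles S l) + card (\<Union>v\<in>V. T v)"
    unfolding X_def by (rule card_Un_le)
  also have "\<dots> \<le> card (short_cycles S l) + (\<Sum>v\<in>V. card (T v))"
    using finite_short_cycles[OF G] fin by (intro add_mono card_image_le card_UN_le) auto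
  finally have "card X \<le> card (short_cycles S l) + (\<Sum>v\<in>V. degree S v - M)" by (simp add: T(2))
  moreover have "card S \<le> card F + card X"
    unfolding F_def using diff_card_le_card_Diff[OF finX, of S] by linarith
  ultimately have "card S \<le> card F + card (short_cycles S l) + (\<Sum>v\<in>V. degree S v - M)" by linarith
  moreover have "degree F v \<le> M" if "v \<in> V" for v
  proof -
    have "degree F v \<le> card ({e \<in> S. v \<in> e} - T v)"
      unfolding degree_def using fin that by (intro card_mono) (auto simp: F_def X_def)
    also have "\<dots> = degree S v - (degree S v - M)"
      using T fin finite_subset[OF T(1)[of v]] by (simp add: card_Diff_subset degree_def)
    finally show ?thesis by linarith
  qed
  moreover have "l \<le> length xs" if xs: "is_cycle F xs" for xs
  proof (rule ccontr)
    assume "\<not> l \<le> length xs"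
    moreover have "is_cycle S xs" using xs by (auto simp: is_cycle_iff F_def)
    ultimately have "c xs \<in> X" by (auto simp: X_def short_cycles_def)
    moreover have "c xs \<in> F" using c[OF xs] xs by (auto simp: is_cycle_iff)
    ultimately show False by (simp add: F_def)
  qed
  ultimately show ?thesis by (intro exI[of _ F]) (auto simp: F_def)
qed

text \<open>The alteration method: the bound \<open>(x - M)\<^sup>+ \<le> (x - \<mu>)\<^sup>2 / (4 (M - \<mu>))\<close> reduces the
  excess degrees to a variance.\<close>

lemma regular_sparse_subgraph:
  fixes \<mu> :: real
  assumes G: "simple_graph V E" and reg: "\<And>v. v \<in> V \<Longrightarrow> degree E v = d"
    and \<mu>: "0 \<le> \<mu>" "\<mu> \<le> real d" "\<mu> < real M" and d: "d > 0"
  shows "\<exists>F\<subseteq>E. (\<forall>v\<in>V. degree F v \<le> M) \<and> (\<forall>xs. is_cycle F xs \<longrightarrow> l \<le> length xs) \<and>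
    \<mu> * real (card V) / 2 - (\<Sum>xs\<in>short_cycles E l. (\<mu> / real d) ^ length xs)
      - real (card V) * (\<mu> / (4 * (real M - \<mu>))) \<le> real (card F)"
proof -
  define p where "p = \<mu> / real d"
  have p: "0 \<le> p" "p \<le> 1" "p * real d = \<mu>" using \<mu> d by (auto simp: p_def)
  have fin: "finite V" "finite E" using G simple_graph_finite_edges by (auto simp: simple_graph_def)
  \<comment> \<open>A lower bound for the number of edges that survive the deletions from
    \<open>S\<close>.\<close>
  define f where "f S = real (card S) - real (card (short_cycles S l)) - (\<Sum>v\<in>V. real (degree S v - M))" for S
  have "2 * real (card E) = real d * real (card V)"
  proof -
    have "real (\<Sum>v\<in>V. degree E v) = real (card V * d)" using reg by simp
    then show ?thesis using handshake[OF G] by simp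
  qed
  then have "random_mean p E (\<lambda>S. real (card S)) = p * (real d * real (card V) / 2)"
    using random_mean_card_Int[OF fin(2) order_refl, of p]
    by (subst random_mean_cong[where g = "\<lambda>S. real (card (E \<inter> S))"]) (auto simp: Int_absorb1)
  then have 1: "random_mean p E (\<lambda>S. real (card S)) = \<mu> * real (card V) / 2"
    using p(3) by simp
  have "random_mean p E (\<lambda>S. real (card (short_cycles S l))) =
      random_mean p E (\<lambda>S. \<Sum>xs\<in>short_cycles E l. of_bool (cycle_edges xs \<subseteq> S))"
  proof (rule random_mean_cong)
    fix S assume "S \<subseteq> E"
    then have "short_cycles S l = short_cycles E l \<inter> {xs. cycle_edges xs \<subseteq> S}"
      by (auto simp: short_cycles_def is_cycle_iff)
    then show "real (card (short_cycles S l)) = (\<Sum>xs\<in>short_cycles E l. of_bool (cycle_edges xs \<subseteq> S))"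
      using finite_short_cycles[OF G] by (simp add: sum_of_bool_eq)
  qed
  also have "\<dots> = (\<Sum>xs\<in>short_cycles E l. p ^ length xs)"
    unfolding random_mean_sum
  proof (rule sum.cong[OF refl])
    fix xs assume "xs \<in> short_cycles E l"
    then have "3 \<le> length xs" "distinct xs" "cycle_edges xs \<subseteq> E" by (auto simp: short_cycles_def is_cycle_iff)
    then show "random_mean p E (\<lambda>S. of_bool (cycle_edges xs \<subseteq> S)) = p ^ length xs"
      using random_mean_subset[OF fin(2)] card_cycle_edges by metis
  qed
  finally have 2: "random_mean p E (\<lambda>S. real (card (short_cycles S l))) = (\<Sum>xs\<in>short_cycles E l. p ^ length xs)" .
  have 3: "random_mean p E (\<lambda>S. real (degree S v - M)) \<le> \<mu> / (4 * (real M - \<mu>))" if v: "v \<in> V" for v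
  proof -
    let ?A = "{e \<in> E. v \<in> e}"
    have cA: "card ?A = d" using reg[OF v] by (simp add: degree_def)
    define \<delta> where "\<delta> = real M - \<mu>"
    have \<delta>: "\<delta> > 0" using \<mu> by (simp add: \<delta>_def)
    have "random_mean p E (\<lambda>S. real (degree S v - M)) \<le>
        random_mean p E (\<lambda>S. 1 / (4 * \<delta>) * (real (card (?A \<inter> S)) - p * real (card ?A))\<^sup>2)"
    proof (rule random_mean_mono[OF p(1,2)])
      fix S assume "S \<subseteq> E"
      then have "degree S v = card (?A \<inter> S)" unfolding degree_def by (intro arg_cong[where f = card]) auto
      moreover have "real (x - M) \<le> 1 / (4 * \<delta>) * (real x - \<mu>)\<^sup>2" for x
      proof (cases "M \<le> x")
        case True
        \<comment> \<open>With \<open>M = \<mu> + \<delta>\<close> this square equals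
          \<open>(x - \<mu>)^2 - 4 * \<delta> * (x - M)\<close>, so its sign is the claim.\<close>
        have "0 \<le> (real x - real M - \<delta>)\<^sup>2" by simp
        also have "\<dots> = (real x - \<mu>)\<^sup>2 - 4 * \<delta> * (real x - real M)"
          by (simp add: \<delta>_def power2_eq_square algebra_simps)
        finally show ?thesis using True \<delta> by (simp add: of_nat_diff field_simps)
      qed (use \<delta> in simp)
      ultimately show "real (degree S v - M) \<le> 1 / (4 * \<delta>) * (real (card (?A \<inter> S)) - p * real (card ?A))\<^sup>2"
        using p(3) cA by simp
    qed
    also have "\<dots> \<le> 1 / (4 * \<delta>) * (p * real (card ?A))"
      unfolding random_mean_mult using fin p \<delta>
      by (intro mult_left_mono random_mean_card_Int_variance) auto
    finally show ?thesis using p(3) cA by (simp add: \<delta>_def)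
  qed
  have "random_mean p E (\<lambda>S. \<Sum>v\<in>V. real (degree S v - M)) \<le> (\<Sum>v\<in>V. \<mu> / (4 * (real M - \<mu>)))"
    unfolding random_mean_sum by (rule sum_mono) (rule 3)
  then have "\<mu> * real (card V) / 2 - (\<Sum>xs\<in>short_cycles E l. p ^ length xs)
      - real (card V) * (\<mu> / (4 * (real M - \<mu>))) \<le> random_mean p E f"
    unfolding f_def random_mean_diff 1 2 by simp
  then obtain S where S: "S \<subseteq> E" "\<mu> * real (card V) / 2 - (\<Sum>xs\<in>short_cycles E l. p ^ length xs)
      - real (card V) * (\<mu> / (4 * (real M - \<mu>))) \<le> f S"
    using random_mean_ge_imp_ex[OF fin(2) p(1,2)] by blast
  obtain F where F: "F \<subseteq> S" "\<forall>v\<in>V. degree F v \<le> M" "\<forall>xs. is_cycle F xs \<longrightarrow> l \<le> length xs"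
    "card S \<le> card F + card (short_cycles S l) + (\<Sum>v\<in>V. degree S v - M)"
    using delete_short_cycles_and_excess_degree[OF simple_graph_subset[OF G S(1)], of M l] by blast
  have "real (card S) \<le> real (card F) + real (card (short_cycles S l)) + (\<Sum>v\<in>V. real (degree S v - M))"
    using of_nat_mono[OF F(4), where 'a = real] by simp
  then have "f S \<le> real (card F)" by (simp add: f_def)
  then show ?thesis using F S by (intro exI[of _ F]) (auto simp: p_def)
qed

section \<open>Short cycles in the hypercube\<close>

definition hypercube_edges :: "nat \<Rightarrow> nat set set" where
  "hypercube_edges d = {{x, flip_bit i x} | x i. x < 2 ^ d \<and> i < d}"

lemma bit_flip_bit_nat: "bit (flip_bit i x) j \<longleftrightarrow> (bit x j \<noteq> (i = j))" for x :: nat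
  by (auto simp: bit_flip_bit_iff)

lemma flip_bit_flip_bit: "flip_bit i (flip_bit i x) = x" for x :: nat
  by (rule bit_eqI) (auto simp: bit_flip_bit_nat)

lemma flip_bit_eq_iff: "flip_bit i x = flip_bit j x \<longleftrightarrow> i = j" for x :: nat
  using bit_flip_bit_nat[of i x i] bit_flip_bit_nat[of j x i] by auto

lemma flip_bit_neq: "flip_bit i x \<noteq> x" for x :: nat
  using bit_flip_bit_nat[of i x i] by auto

lemma flip_bit_less: "x < 2 ^ d \<Longrightarrow> i < d \<Longrightarrow> flip_bit i x < 2 ^ d" for x :: nat
  by (metis not_le take_bit_flip_bit_eq take_bit_nat_eq_self_iff)

lemma hypercube_graph: "simple_graph {..<2 ^ d} (hypercube_edges d)"
  by (auto simp: simple_graph_def hypercube_edges_def flip_bit_less card_insert_if flip_bit_neq[symmetric])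

lemma hypercube_neighbour:
  assumes "{x, y} \<in> hypercube_edges d"
  shows "\<exists>i<d. y = flip_bit i x"
  using assms by (auto simp: hypercube_edges_def doubleton_eq_iff flip_bit_flip_bit)

lemma hypercube_degree:
  assumes "v < 2 ^ d"
  shows "degree (hypercube_edges d) v = d"
proof -
  have "{e \<in> hypercube_edges d. v \<in> e} = (\<lambda>i. {v, flip_bit i v}) ` {..<d}"
  proof (intro equalityI subsetI)
    fix e assume e: "e \<in> {e \<in> hypercube_edges d. v \<in> e}"
    then obtain y where y: "e = {v, y}" by (auto simp: hypercube_edges_def)
    then obtain i where "i < d" "y = flip_bit i v" using hypercube_neighbour e by blast
    then show "e \<in> (\<lambda>i. {v, flip_bit i v}) ` {..<d}" using y by auto
  qed (use assms in \<open>auto simp: hypercube_edges_def\<close>)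
  moreover have "inj_on (\<lambda>i. {v, flip_bit i v}) {..<d}"
    by (rule inj_onI) (auto simp: doubleton_eq_iff flip_bit_eq_iff flip_bit_neq)
  ultimately show ?thesis by (simp add: degree_def card_image)
qed

text \<open>Direction sequences of closed walks: a walk in the cube returns to its start exactly if
  it flips every coordinate an even number of times.\<close>

definition even_words :: "nat \<Rightarrow> nat \<Rightarrow> nat list set" where
  "even_words d m = {w. length w = m \<and> set w \<subseteq> {..<d} \<and> (\<forall>i. even (count_list w i))}"

lemma finite_even_words: "finite (even_words d m)"
  by (rule finite_subset[OF _ finite_lists_length_eq[of "{..<d}" m]]) (auto simp: even_words_def)

lemma even_words_odd:
  assumes "odd m"
  shows "even_words d m = {}"
proof -
  have "even (length w)" if "\<forall>i. even (count_list w i)" for w :: "nat list"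
    using sum_count_set[of w "set w"] that by (metis List.finite_set dvd_sum order_refl)
  then show ?thesis using assms by (auto simp: even_words_def)
qed

text \<open>The first letter of an even word occurs again; delete both occurrences.\<close>

lemma card_even_words_Suc_Suc:
  "card (even_words d (Suc (Suc m))) \<le> (m + 1) * d * card (even_words d m)"
proof -
  let ?f = "\<lambda>(i, j, w). i # take j w @ i # drop j w"
  let ?A = "{..<d} \<times> {..m} \<times> even_words d m"
  have "even_words d (Suc (Suc m)) \<subseteq> ?f ` ?A"
  proof
    fix u assume u: "u \<in> even_words d (Suc (Suc m))"
    then obtain i r where r: "u = i # r" by (cases u) (auto simp: even_words_def)
    have ev: "even (count_list u j)" for j using u by (auto simp: even_words_def)
    have "i \<in> set r"
    proof (rule ccontr)
      assume "i \<notin> set r"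
      then have "count_list u i = 1" using r by (simp add: count_notin)
      then show False using ev[of i] by simp
    qed
    then obtain a b where ab: "r = a @ i # b" by (meson split_list)
    have "even (count_list (a @ b) j)" for j
      using ev[of j] by (cases "i = j") (auto simp: r ab)
    then have "a @ b \<in> even_words d m" "i < d" "length a \<le> m"
      using u by (auto simp: even_words_def r ab)
    then have "(i, length a, a @ b) \<in> ?A" by auto
    moreover have "u = ?f (i, length a, a @ b)" by (simp add: r ab)
    ultimately show "u \<in> ?f ` ?A" by (rule rev_image_eqI)
  qed
  then have "card (even_words d (Suc (Suc m))) \<le> card ?A"
    by (rule surj_card_le[rotated]) (simp add: finite_even_words)
  then show ?thesis by (simp add: card_cartesian_product algebra_simps)
qed

text \<open>Removing pairs of equal letters one after the other gives factors
  \<open>(2 * j + 1) * d\<close> with \<open>j < l\<close>, each at most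
  \<open>2 * l * d\<close>.\<close>

lemma card_even_words: "card (even_words d (2 * l)) \<le> (2 * l * d) ^ l"
proof (induction l)
  case 0
  have "even_words d 0 = {[]}" by (auto simp: even_words_def)
  then show ?case by simp
next
  case (Suc l)
  have "card (even_words d (2 * Suc l)) \<le> (2 * l + 1) * d * card (even_words d (2 * l))"
    using card_even_words_Suc_Suc[of d "2 * l"] by simp
  also have "\<dots> \<le> (2 * Suc l * d) * (2 * Suc l * d) ^ l"
  proof (rule mult_mono)
    have "(2 * l * d) ^ l \<le> (2 * Suc l * d) ^ l" by (intro power_mono mult_le_mono) auto
    then show "card (even_words d (2 * l)) \<le> (2 * Suc l * d) ^ l" using Suc.IH by linarith
  qed auto
  finally show ?case by simp
qed

lemma bit_fold_flip_bit: "bit (fold flip_bit w x) i \<longleftrightarrow> (bit x i \<noteq> odd (count_list w i))" for x :: nat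
  by (induction w arbitrary: x) (auto simp: bit_flip_bit_nat)

text \<open>A cycle is determined by its first vertex and the sequence of its directions, and each
  direction is used an even number of times.\<close>

lemma hypercube_cycles_subset:
  "{xs. is_cycle (hypercube_edges d) xs \<and> length xs = m} \<subseteq>
    (\<lambda>(x, w). map (\<lambda>j. fold flip_bit (take j w) x) [0..<m]) ` ({..<2 ^ d} \<times> even_words d m)"
proof
  fix xs assume "xs \<in> {xs. is_cycle (hypercube_edges d) xs \<and> length xs = m}"
  then have xs: "is_cycle (hypercube_edges d) xs" "length xs = m" by auto
  have m: "3 \<le> m" using xs by (auto simp: is_cycle_def)
  define x where "x = xs ! 0"
  have "x \<in> set xs" using m xs(2) unfolding x_def by (intro nth_mem) linarith
  then have x: "x < 2 ^ d" using is_cycle_subset_vertices[OF hypercube_graph xs(1)] by auto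
  have "\<forall>j<m. \<exists>i<d. xs ! (Suc j mod m) = flip_bit i (xs ! j)"
    using xs hypercube_neighbour unfolding is_cycle_def by blast
  then obtain dir where dir: "\<And>j. j < m \<Longrightarrow> dir j < d" "\<And>j. j < m \<Longrightarrow> xs ! (Suc j mod m) = flip_bit (dir j) (xs ! j)"
    by metis
  define w where "w = map dir [0..<m]"
  \<comment> \<open>The index modulo \<open>m\<close> makes the case \<open>j = m\<close> say that
    the walk is back at \<open>x\<close>.\<close>
  have walk: "fold flip_bit (take j w) x = xs ! (j mod m)" if "j \<le> m" for j
    using that
  proof (induction j)
    case (Suc j)
    then have "take (Suc j) w = take j w @ [dir j]"
      by (simp add: w_def take_Suc_conv_app_nth)
    then show ?case using Suc dir(2)[of j] by simp
  qed (simp add: x_def)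
  have "fold flip_bit w x = x" using walk[of m] by (simp add: w_def x_def)
  then have "even (count_list w i)" for i using bit_fold_flip_bit[of w x i] by auto
  then have "w \<in> even_words d m" using dir(1) by (auto simp: even_words_def w_def)
  then have "(x, w) \<in> {..<2 ^ d} \<times> even_words d m" using x by simp
  moreover have "xs = (\<lambda>(x, w). map (\<lambda>j. fold flip_bit (take j w) x) [0..<m]) (x, w)"
    unfolding prod.case by (rule nth_equalityI) (use xs walk in auto)
  ultimately show "xs \<in> (\<lambda>(x, w). map (\<lambda>j. fold flip_bit (take j w) x) [0..<m]) ` ({..<2 ^ d} \<times> even_words d m)"
    by (rule rev_image_eqI)
qed

lemma hypercube_cycle_even:
  assumes "is_cycle (hypercube_edges d) xs"
  shows "even (length xs)"
proof (rule ccontr)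
  assume "odd (length xs)"
  from even_words_odd[OF this, of d] show False
    using hypercube_cycles_subset[of d "length xs"] assms by auto
qed

lemma card_hypercube_cycles:
  "card {xs. is_cycle (hypercube_edges d) xs \<and> length xs = 2 * l} \<le> 2 ^ d * (2 * l * d) ^ l"
proof -
  have "card {xs. is_cycle (hypercube_edges d) xs \<and> length xs = 2 * l} \<le>
      card ({..<2 ^ d :: nat} \<times> even_words d (2 * l))"
    by (rule surj_card_le[OF _ hypercube_cycles_subset]) (simp add: finite_even_words)
  also have "\<dots> \<le> 2 ^ d * (2 * l * d) ^ l"
    using card_even_words[of d l] by (simp add: card_cartesian_product)
  finally show ?thesis .
qed

text \<open>Cycles of the cube have length \<open>2 * l\<close> with \<open>l\<close> at least 2, so
  the geometric series starts there and stays below 1/6.\<close>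

lemma sum_third_powers: "(\<Sum>l\<in>{2..<n + 2}. (1 / 3 :: real) ^ l) = (1 - (1 / 3) ^ n) / 6"
proof (induction n)
  case (Suc n)
  have "(\<Sum>l\<in>{2..<Suc n + 2}. (1 / 3 :: real) ^ l) = (\<Sum>l\<in>{2..<n + 2}. (1 / 3) ^ l) + (1 / 3) ^ (n + 2)"
    by simp
  also have "\<dots> = (1 - (1 / 3) ^ n) / 6 + (1 / 3) ^ n / 9"
    unfolding Suc.IH by (simp add: power_add power2_eq_square)
  also have "\<dots> = (1 - (1 / 3) ^ Suc n) / 6" by (simp add: diff_divide_distrib)
  finally show ?case .
qed simp

text \<open>The cycles of length \<open>2 * m\<close> weigh at most
  \<open>2 ^ d * (2 * m * d * p^2) ^ m\<close>, and the base of the last power is at most 1/3 by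
  assumption.\<close>

lemma hypercube_short_cycles_weight:
  fixes p :: real
  assumes p: "0 \<le> p" and l: "\<And>c. c < l \<Longrightarrow> real c * (real d * p\<^sup>2) \<le> 1 / 3"
  shows "(\<Sum>xs\<in>short_cycles (hypercube_edges d) l. p ^ length xs) \<le> 2 ^ d / 6"
proof -
  define C where "C m = {xs \<in> short_cycles (hypercube_edges d) l. length xs = 2 * m}" for m
  have fin: "finite (short_cycles (hypercube_edges d) l)" by (rule finite_short_cycles[OF hypercube_graph])
  have "short_cycles (hypercube_edges d) l = (\<Union>m\<in>{2..<l + 2}. C m)"
  proof (intro equalityI subsetI)
    fix xs assume xs: "xs \<in> short_cycles (hypercube_edges d) l"
    then have "even (length xs)" "3 \<le> length xs" "length xs < l"
      using hypercube_cycle_even by (auto simp: short_cycles_def is_cycle_def)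
    then have "xs \<in> C (length xs div 2)" "length xs div 2 \<in> {2..<l + 2}" using xs by (auto simp: C_def)
    then show "xs \<in> (\<Union>m\<in>{2..<l + 2}. C m)" by blast
  qed (auto simp: C_def)
  then have "(\<Sum>xs\<in>short_cycles (hypercube_edges d) l. p ^ length xs) =
      (\<Sum>xs\<in>(\<Union>m\<in>{2..<l + 2}. C m). p ^ length xs)" by simp
  also have "\<dots> = (\<Sum>m\<in>{2..<l + 2}. \<Sum>xs\<in>C m. p ^ length xs)"
    using fin by (intro sum.UNION_disjoint) (auto simp: C_def)
  also have "\<dots> \<le> (\<Sum>m\<in>{2..<l + 2}. 2 ^ d * (1 / 3) ^ m)"
  proof (rule sum_mono)
    fix m
    show "(\<Sum>xs\<in>C m. p ^ length xs) \<le> 2 ^ d * (1 / 3) ^ m"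
    proof (cases "2 * m < l")
      case True
      have "{xs. is_cycle (hypercube_edges d) xs \<and> length xs = 2 * m} = C m"
        using True by (auto simp: C_def short_cycles_def)
      then have "card (C m) \<le> 2 ^ d * (2 * m * d) ^ m"
        using card_hypercube_cycles[of d m] by simp
      then have "real (card (C m)) \<le> 2 ^ d * (2 * real m * real d) ^ m"
        by (metis (mono_tags, lifting) of_nat_le_iff of_nat_mult of_nat_numeral of_nat_power)
      then have "(\<Sum>xs\<in>C m. p ^ length xs) \<le> 2 ^ d * (2 * real m * real d) ^ m * (p ^ (2 * m))"
        using p by (simp add: C_def mult_right_mono)
      also have "\<dots> = 2 ^ d * (real (2 * m) * (real d * p\<^sup>2)) ^ m"
        by (simp add: power_mult power_mult_distrib mult.assoc)
      also have "\<dots> \<le> 2 ^ d * (1 / 3) ^ m"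
        using l[OF True] p by (intro mult_left_mono power_mono) auto
      finally show ?thesis .
    next
      case False
      then have "C m = {}" by (auto simp: C_def short_cycles_def)
      then show ?thesis by simp
    qed
  qed
  also have "\<dots> = 2 ^ d * ((1 - (1 / 3) ^ l) / 6)"
    by (simp only: sum_distrib_left[symmetric] sum_third_powers)
  also have "\<dots> \<le> 2 ^ d / 6" by simp
  finally show ?thesis .
qed

text \<open>Mean degree \<open>3 * k\<close> gives \<open>3 * k / 2\<close> edges per vertex on
  average. Short cycles cost at most 1/6 and excess degrees at most 3/10 per vertex, less than
  \<open>k / 2\<close>, so \<open>k\<close> edges per vertex remain.\<close>

lemma hypercube_sparse_subgraph:
  fixes k :: real
  assumes k: "2 \<le> k" "3 * k \<le> real d" and l: "\<And>c. c < l \<Longrightarrow> 27 * k\<^sup>2 * real c \<le> real d"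
  shows "\<exists>F\<subseteq>hypercube_edges d. (\<forall>v<2 ^ d. real (degree F v) \<le> 6 * k) \<and>
    (\<forall>xs. is_cycle F xs \<longrightarrow> l \<le> length xs) \<and> k * 2 ^ d \<le> real (card F)"
proof -
  define M where "M = nat \<lfloor>6 * k\<rfloor>"
  have M: "real M \<le> 6 * k" "6 * k - 1 < real M" using k unfolding M_def by linarith+
  have d: "d > 0" using k by (cases d) auto
  define p where "p = 3 * k / real d"
  have "(\<Sum>xs\<in>short_cycles (hypercube_edges d) l. p ^ length xs) \<le> 2 ^ d / 6"
  proof (rule hypercube_short_cycles_weight)
    fix c assume "c < l"
    from l[OF this] show "real c * (real d * p\<^sup>2) \<le> 1 / 3"
      using d by (simp add: p_def power2_eq_square field_simps)
  qed (use k in \<open>simp add: p_def\<close>)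
  \<comment> \<open>Since \<open>M > 6 * k - 1\<close>, the quotient is below
    \<open>3 * k / (4 * (3 * k - 1))\<close>, which is largest at \<open>k = 2\<close>, with value
    3/10.\<close>
  moreover have "3 * k / (4 * (real M - 3 * k)) \<le> 3 / 10"
    using M k by (simp add: field_simps)
  then have "2 ^ d * (3 * k / (4 * (real M - 3 * k))) \<le> (2 ^ d :: real) * (3 / 10)"
    by (intro mult_left_mono) auto
  moreover obtain F where F: "F \<subseteq> hypercube_edges d" "\<forall>v\<in>{..<2 ^ d}. degree F v \<le> M"
    "\<forall>xs. is_cycle F xs \<longrightarrow> l \<le> length xs"
    "3 * k * real (card {..<2 ^ d :: nat}) / 2 - (\<Sum>xs\<in>short_cycles (hypercube_edges d) l. p ^ length xs)
      - real (card {..<2 ^ d :: nat}) * (3 * k / (4 * (real M - 3 * k))) \<le> real (card F)"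
    using regular_sparse_subgraph[OF hypercube_graph, of d d "3 * k" M l] hypercube_degree k M d
    unfolding p_def by auto
  moreover have "2 * 2 ^ d \<le> k * (2 ^ d :: real)" using k by simp
  moreover have "real (card {..<2 ^ d :: nat}) = 2 ^ d" by simp
  ultimately have "k * 2 ^ d \<le> real (card F)" by (simp only:)
  moreover have "\<forall>v<2 ^ d. real (degree F v) \<le> 6 * k"
    using F(2) M(1) by (meson lessThan_iff of_nat_le_iff order_trans)
  ultimately show ?thesis using F by blast
qed

section \<open>Separators of subgraphs of the sparse hypercube\<close>

lemma le_two_powr:
  fixes z :: real
  assumes "0 \<le> z"
  shows "z \<le> 2 powr z"
proof -
  define m where "m = nat \<lfloor>z\<rfloor>"
  have m: "real m \<le> z" "z < real m + 1" using assms unfolding m_def by linarith+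
  have "real m + 1 \<le> 2 ^ m"
    using of_nat_mono[OF Suc_leI[OF less_exp[of m]], where 'a = real] by simp
  also have "\<dots> = 2 powr real m" by (simp add: powr_realpow)
  also have "\<dots> \<le> 2 powr z" using m(1) by simp
  finally show ?thesis using m by linarith
qed

lemma le_two_powr_16th:
  fixes L :: real
  assumes "160 \<le> L"
  shows "L \<le> 2 powr (L / 16)"
proof -
  \<comment> \<open>The threshold 160 gives \<open>5 \<le> L / 32\<close>, which absorbs the factor
    32.\<close>
  have "L = 2 powr 5 * (L / 32)" by simp
  also have "\<dots> \<le> 2 powr 5 * 2 powr (L / 32)" using assms by (intro mult_left_mono le_two_powr) auto
  also have "\<dots> = 2 powr (5 + L / 32)" by (simp only: powr_add)
  also have "\<dots> \<le> 2 powr (L / 16)" using assms by (intro powr_mono) auto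
  finally show ?thesis .
qed

lemma is_cycle_mono: "is_cycle F xs \<Longrightarrow> F \<subseteq> E \<Longrightarrow> is_cycle E xs"
  by (auto simp: is_cycle_def)

text \<open>In the application \<open>a\<close> is \<open>log n\<close>, \<open>L\<close> is
  \<open>log log n\<close>, \<open>g\<close> bounds both the girth and the order of the subgraph
  from below, and \<tau> is \<open>log t\<close>. The dimension \<open>d + 1\<close> makes room for
  the isolated vertices, which are numbered from \<open>2 ^ d\<close> on.\<close>

locale sparse_hypercube_subgraph =
  fixes W :: "nat set" and F :: "nat set set" and d :: nat and k a L g \<tau> :: real
  assumes G: "simple_graph W F" and W: "W \<subseteq> {..<2 ^ (d + 1)}"
    and F: "\<And>e. e \<in> F \<Longrightarrow> \<exists>x i. i < d + 1 \<and> e = {x, flip_bit i x}"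
    and deg: "\<And>v. v \<in> W \<Longrightarrow> real (degree F v) \<le> 6 * k"
    and cyc: "\<And>xs. is_cycle F xs \<Longrightarrow> g \<le> real (length xs)"
    and k: "2 \<le> k" "k \<le> L / 648" and a: "a = 2 powr L" "real d \<le> a"
    and g: "g = a / (6 * k)\<^sup>2" "g \<le> real (card W)"
    and \<tau>: "\<tau> = log 2 (real (card W))"
begin

lemma L: "1296 \<le> L"
  using k by linarith

lemma L_powers: "L ^ 2 \<le> 2 powr (L / 8)" "L ^ 4 \<le> 2 powr (L / 4)"
proof -
  have "L ^ m \<le> 2 powr (m * (L / 16))" for m
  proof -
    have "L ^ m \<le> (2 powr (L / 16)) ^ m" using L by (intro power_mono le_two_powr_16th) auto
    also have "\<dots> = 2 powr (m * (L / 16))" by (simp add: powr_power mult.commute)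
    finally show ?thesis .
  qed
  from this[of 2] this[of 4] show "L ^ 2 \<le> 2 powr (L / 8)" "L ^ 4 \<le> 2 powr (L / 4)" by simp_all
qed

lemma a_le: "a \<le> L ^ 2 * g"
proof -
  have "(6 * k)\<^sup>2 \<le> L ^ 2" using k by (intro power_mono) auto
  moreover have "0 \<le> g" using g a by simp
  ultimately have "(6 * k)\<^sup>2 * g \<le> L ^ 2 * g" by (rule mult_right_mono)
  then show ?thesis using g k by simp
qed

lemma g_ge: "2 powr (L / 2) \<le> g"
proof -
  have "2 powr (L / 2) * 2 powr (L / 2) = a" by (simp add: a flip: powr_add)
  also have "\<dots> \<le> L ^ 2 * g" by (rule a_le)
  also have "\<dots> \<le> 2 powr (L / 2) * g"
  proof (rule mult_right_mono)
    have "2 powr (L / 8) \<le> 2 powr (L / 2)" using L by (intro powr_mono) auto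
    then show "L ^ 2 \<le> 2 powr (L / 2)" using L_powers by linarith
  qed (use g a in simp)
  finally show ?thesis by (rule mult_left_le_imp_le) simp
qed

lemma card_W: "real (card W) = 2 powr \<tau>" and \<tau>_ge: "648 \<le> \<tau>"
proof -
  have t: "2 powr (L / 2) \<le> real (card W)" using g_ge g by linarith
  moreover have "(0 :: real) < 2 powr (L / 2)" by simp
  ultimately have pos: "0 < real (card W)" by linarith
  then show "real (card W) = 2 powr \<tau>" using \<tau> by simp
  have "L / 2 \<le> \<tau>" unfolding \<tau> using t pos by (subst le_log_iff) auto
  then show "648 \<le> \<tau>" using L by linarith
qed

text \<open>A radius of about \<open>\<tau> / (2 * L)\<close> keeps Hamming balls near the square
  root of \<open>t\<close>, so coordinate cuts apply. The resulting factor \<open>16 * k * L\<close>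
  is at most \<open>(L / 4)^2\<close> because \<open>k \<le> L / 648\<close>.\<close>

lemma separator_large:
  assumes large: "L / 4 \<le> log 2 \<tau>"
  shows "ereal_of_enat (sep_E W F) \<le> ereal (real (card W) / \<tau> * (log 2 \<tau>)\<^sup>2)"
proof -
  \<comment> \<open>This is \<open>2 * (6 * k) / (r + 1)\<close> with \<open>r + 1\<close> replaced
    by its lower bound \<open>\<tau> / (2 * L)\<close>.\<close>
  define \<alpha> where "\<alpha> = 24 * k * L / \<tau>"
  define r where "r = nat \<lfloor>\<tau> / (2 * L)\<rfloor>"
  have pos: "0 \<le> \<tau> / (2 * L)" using \<tau>_ge L by simp
  have r: "real r \<le> \<tau> / (2 * L)" "\<tau> / (2 * L) < real r + 1"
    using pos unfolding r_def by linarith+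
  have "real (2 * (d + 1 + 1) ^ r) = 2 * (real d + 2) ^ r" by (simp add: add.commute)
  also have "\<dots> \<le> 2 * (2 powr (L + 1)) ^ r"
  proof -
    have "(2 :: real) powr 1 \<le> 2 powr L" using L by (intro powr_mono) auto
    then have "real d + 2 \<le> 2 powr (L + 1)" using a by (simp add: powr_add)
    then show ?thesis by (intro mult_left_mono power_mono) auto
  qed
  also have "\<dots> = 2 powr (1 + (L + 1) * r)"
    unfolding powr_add[of 2 1] by (simp add: powr_powr flip: powr_realpow)
  also have "\<dots> \<le> 2 powr (\<tau> - 1)"
  proof (rule powr_mono)
    have "(L + 1) * r \<le> (L + 1) * (\<tau> / (2 * L))" using r L by (intro mult_left_mono) auto
    also have "\<dots> = \<tau> / 2 + \<tau> / (2 * L)" using L by (simp add: field_simps)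
    also have "\<tau> / (2 * L) \<le> \<tau> / 10" using L \<tau>_ge by (intro divide_left_mono) auto
    finally show "1 + (L + 1) * r \<le> \<tau> - 1" using \<tau>_ge by linarith
  qed simp
  also have "\<dots> = real (card W) / 2" unfolding card_W by (simp add: powr_diff)
  finally have ball: "real (2 * (d + 1 + 1) ^ r) \<le> real (card W) / 2" .
  have "ereal_of_enat (sep_E W F) \<le> ereal (2 / 3 * \<alpha> * real (card W))"
  proof (rule sep_E_le_of_sparse_cuts[OF G])
    show "0 \<le> \<alpha>" using k L \<tau>_ge by (simp add: \<alpha>_def)
    fix U assume U: "U \<subseteq> W" "2 / 3 * real (card W) < real (card U)"
    then have "real (2 * (d + 1 + 1) ^ r) \<le> real (card U)" using ball by linarith
    then have "2 * (d + 1 + 1) ^ r \<le> card U" by (simp only: of_nat_le_iff)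
    moreover from U have "U \<noteq> {}" by auto
    ultimately obtain X where X: "X \<subseteq> U" "X \<noteq> {}" "2 * card X \<le> card U"
      "real (card (edge_cut F X (U - X))) \<le> 2 * (6 * k) / (real r + 1) * real (card X)"
      using hypercube_sparse_cut[OF G W F deg U(1)] by blast
    have "2 * (6 * k) / (real r + 1) \<le> 2 * (6 * k) / (\<tau> / (2 * L))"
      using r k L \<tau>_ge by (intro divide_left_mono) auto
    also have "\<dots> = \<alpha>" by (simp add: \<alpha>_def)
    finally have "2 * (6 * k) / (real r + 1) * real (card X) \<le> \<alpha> * real (card X)"
      by (rule mult_right_mono) simp
    then show "\<exists>X\<subseteq>U. X \<noteq> {} \<and> 2 * card X \<le> card U \<and> real (card (edge_cut F X (U - X))) \<le> \<alpha> * real (card X)"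
      using X by (intro exI[of _ X]) auto
  qed
  also have "2 / 3 * \<alpha> * real (card W) = real (card W) / \<tau> * (16 * k * L)" by (simp add: \<alpha>_def)
  also have "ereal \<dots> \<le> ereal (real (card W) / \<tau> * (log 2 \<tau>)\<^sup>2)"
  proof -
    have "16 * k * L \<le> (L / 4) * (L / 4)" using k L mult_right_mono[of k "L / 648" L] by simp
    also have "\<dots> \<le> (log 2 \<tau>)\<^sup>2" unfolding power2_eq_square using large L by (intro mult_mono) auto
    finally show ?thesis using \<tau>_ge by (simp add: mult_left_mono divide_right_mono)
  qed
  finally show ?thesis .
qed

text \<open>Here the girth exceeds a multiple of \<open>(L * \<tau>)^2\<close>, so the growth rate
  \<open>y\<close> of some ball can be taken tiny and the cuts have density at most
  \<open>1 / \<tau>\<close>; the factor \<open>(log 2 \<tau>)^2\<close> is not exploited beyond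
  being at least 1.\<close>

lemma separator_small:
  assumes small: "log 2 \<tau> < L / 4"
  shows "ereal_of_enat (sep_E W F) \<le> ereal (real (card W) / \<tau> * (log 2 \<tau>)\<^sup>2)"
proof -
  have \<tau>_le: "\<tau> \<le> 2 powr (L / 4)" using small \<tau>_ge by (subst (asm) log_less_iff) auto
  \<comment> \<open>\<open>a = 2 powr L\<close> splits into two halves: one bounds
    \<open>\<tau>^2\<close>, the other \<open>2 * L ^ 4\<close>. A factor \<open>L^2\<close> is then
    lost in passing from \<open>a\<close> to \<open>g\<close>.\<close>
  have key: "2 * L\<^sup>2 * \<tau>\<^sup>2 \<le> g"
  proof -
    have "\<tau>\<^sup>2 \<le> (2 powr (L / 4))\<^sup>2" using \<tau>_le \<tau>_ge by (intro power_mono) auto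
    also have "\<dots> = 2 powr (L / 2)" by (simp add: powr_power)
    finally have \<tau>2: "\<tau>\<^sup>2 \<le> 2 powr (L / 2)" .
    have "2 * L ^ 4 \<le> 2 powr 1 * 2 powr (L / 4)" using L_powers by simp
    also have "\<dots> = 2 powr (1 + L / 4)" by (simp only: powr_add)
    also have "\<dots> \<le> 2 powr (L / 2)" using L by (intro powr_mono) auto
    finally have "(2 * L ^ 4) * \<tau>\<^sup>2 \<le> 2 powr (L / 2) * 2 powr (L / 2)"
      using \<tau>2 by (intro mult_mono) auto
    also have "\<dots> = a" by (simp add: a flip: powr_add)
    also have "\<dots> \<le> L ^ 2 * g" by (rule a_le)
    finally have "L ^ 2 * (2 * L\<^sup>2 * \<tau>\<^sup>2) \<le> L ^ 2 * g" by (simp add: eval_nat_numeral algebra_simps)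
    then show ?thesis using L by simp
  qed
  have L\<tau>: "1 \<le> L ^ 2 * \<tau>" "16 \<le> L ^ 2" "L \<le> L ^ 2"
  proof -
    show "16 \<le> L ^ 2" using L power_mono[of 4 L 2] by simp
    show "L \<le> L ^ 2" using L self_le_power[of L 2] by simp
    show "1 \<le> L ^ 2 * \<tau>" using \<open>16 \<le> L ^ 2\<close> \<tau>_ge mult_mono[of 1 "L ^ 2" 1 \<tau>] by simp
  qed
  have g32: "32 * \<tau> \<le> g"
  proof -
    have "16 * 1 \<le> L\<^sup>2 * \<tau>" using L\<tau>(2) \<tau>_ge by (intro mult_mono) auto
    then have "16 * (2 * \<tau>) \<le> L\<^sup>2 * \<tau> * (2 * \<tau>)" using \<tau>_ge by (intro mult_right_mono) auto
    then show ?thesis using key by (simp add: power2_eq_square algebra_simps)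
  qed
  then have g0: "8 \<le> g" using \<tau>_ge by linarith
  \<comment> \<open>With \<open>R \<ge> g / 8\<close> and \<open>ln (1 + y) \<ge> y / 2\<close> the
    constant 16 yields \<open>R * ln (1 + y) \<ge> \<tau>\<close>; \<open>R \<le> g / 4\<close>
    keeps \<open>2 * R + 1\<close> below the girth.\<close>
  define y where "y = 16 * \<tau> / g"
  define R where "R = nat \<lfloor>g / 4\<rfloor>"
  define D where "D = nat \<lfloor>6 * k\<rfloor>"
  have y: "0 \<le> y" "y \<le> 1 / 2" using g32 g0 \<tau>_ge by (auto simp: y_def field_simps)
  have R: "real R \<le> g / 4" "g / 8 \<le> real R" using g0 unfolding R_def by linarith+
  have D: "real D \<le> 6 * k" using k unfolding D_def by linarith
  have growth: "real (card W) < (1 + y) ^ R"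
  proof -
    have "real (card W) = exp (ln 2 * \<tau>)" unfolding card_W by (simp add: powr_def mult.commute)
    also have "\<dots> < exp \<tau>" using \<tau>_ge ln_2_less_1 by simp
    also have "\<dots> \<le> exp (real R * ln (1 + y))"
    proof -
      have "y * y \<le> y * (1 / 2)" using y by (intro mult_left_mono) auto
      then have "y / 2 \<le> y - y\<^sup>2" by (simp add: power2_eq_square)
      also have "\<dots> \<le> ln (1 + y)" using y by (intro ln_one_plus_pos_lower_bound) auto
      finally have "(g / 8) * (y / 2) \<le> real R * ln (1 + y)" using R y g0 by (intro mult_mono) auto
      then show ?thesis using g0 by (simp add: y_def)
    qed
    also have "\<dots> = (1 + y) ^ R" using y by (simp add: exp_of_nat_mult)
    finally show ?thesis .
  qed
  have "ereal_of_enat (sep_E W F) \<le> ereal (2 / 3 * (1 / \<tau>) * real (card W))"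
  proof (rule sep_E_le_of_sparse_cuts[OF G])
    show "0 \<le> 1 / \<tau>" using \<tau>_ge by simp
    fix U assume U: "U \<subseteq> W" "2 / 3 * real (card W) < real (card U)"
    define F' where "F' = {e \<in> F. e \<subseteq> U}"
    have G': "simple_graph U F'"
      using G U by (auto simp: simple_graph_def F'_def finite_subset)
    have "card U \<le> card W" using G U by (intro card_mono) (auto simp: simple_graph_def)
    have u: "2 / 3 * g < real (card U)" using U g by linarith
    have deg': "degree F' w \<le> D" if "w \<in> U" for w
    proof -
      have "degree F' w \<le> degree F w"
        by (rule degree_mono) (use simple_graph_finite_edges[OF G] in \<open>auto simp: F'_def\<close>)
      moreover have "degree F w \<le> D" using deg[of w] that U unfolding D_def by (auto simp: le_nat_floor)
      ultimately show ?thesis by simp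
    qed
    have cyc': "2 * R + 1 < length xs" if "is_cycle F' xs" for xs
    proof -
      have "g \<le> real (length xs)" using cyc is_cycle_mono[OF that, of F] by (auto simp: F'_def)
      then have "real (2 * R + 1) < real (length xs)" using R g0 by simp
      then show ?thesis by (simp only: of_nat_less_iff)
    qed
    have "real 8 \<le> real (card U)" using u g32 \<tau>_ge by simp
    then have "8 \<le> card U" by (simp only: of_nat_le_iff)
    moreover have "real (card U) < (1 + y) ^ R" using growth \<open>card U \<le> card W\<close> by linarith
    ultimately obtain X where X: "X \<subseteq> U" "X \<noteq> {}" "2 * card X \<le> card U"
      "real (card (edge_cut F' X (U - X))) \<le>
        (8 * real D / real (card U) + 4 * (real D)\<^sup>2 * y) * real (card X)"
      using high_girth_sparse_cut[OF G' deg' cyc' y(1)] by blast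
    have "edge_cut F' X (U - X) = edge_cut F X (U - X)"
      using X(1) by (auto simp: edge_cut_def F'_def)
    \<comment> \<open>Each summand is at most \<open>L^2 * \<tau> / g\<close>, and twice that is at
      most \<open>1 / \<tau>\<close> by \<open>key\<close>.\<close>
    moreover have "8 * real D / real (card U) + 4 * (real D)\<^sup>2 * y \<le> 1 / \<tau>"
    proof -
      have DL: "real D \<le> L / 108" using D k by linarith
      have "8 * real D / real (card U) \<le> (8 * (L / 108)) / (2 / 3 * g)"
        using DL u g0 by (intro frac_le) auto
      also have "\<dots> \<le> L / g" using L g0 by (simp add: field_simps)
      also have "\<dots> \<le> L\<^sup>2 * \<tau> / g"
      proof -
        have "L * 1 \<le> L\<^sup>2 * \<tau>" using L\<tau>(3) \<tau>_ge by (intro mult_mono) auto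
        then show ?thesis using g0 by (simp add: divide_right_mono)
      qed
      finally have 1: "8 * real D / real (card U) \<le> L\<^sup>2 * \<tau> / g" .
      have "4 * (real D)\<^sup>2 * y \<le> 4 * (L / 108)\<^sup>2 * y"
        using DL y by (intro mult_right_mono mult_left_mono power_mono) auto
      also have "\<dots> \<le> L\<^sup>2 * \<tau> / g" using g0 \<tau>_ge by (simp add: y_def power_divide field_simps)
      finally have "8 * real D / real (card U) + 4 * (real D)\<^sup>2 * y \<le> L\<^sup>2 * \<tau> / g + L\<^sup>2 * \<tau> / g"
        by (rule add_mono[OF 1])
      also have "\<dots> \<le> 1 / \<tau>" using key g0 \<tau>_ge by (simp add: field_simps power2_eq_square)
      finally show ?thesis .
    qed
    then have "(8 * real D / real (card U) + 4 * (real D)\<^sup>2 * y) * real (card X) \<le> 1 / \<tau> * real (card X)"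
      by (rule mult_right_mono) simp
    ultimately show "\<exists>X\<subseteq>U. X \<noteq> {} \<and> 2 * card X \<le> card U \<and>
        real (card (edge_cut F X (U - X))) \<le> 1 / \<tau> * real (card X)"
      using X by (intro exI[of _ X]) auto
  qed
  also have "2 / 3 * (1 / \<tau>) * real (card W) = real (card W) / \<tau> * (2 / 3)" by simp
  also have "ereal \<dots> \<le> ereal (real (card W) / \<tau> * (log 2 \<tau>)\<^sup>2)"
  proof -
    have "1 \<le> log 2 \<tau>" using \<tau>_ge by (simp add: le_log_iff)
    then have "1 \<le> (log 2 \<tau>)\<^sup>2" by (rule one_le_power)
    then have "2 / 3 \<le> (log 2 \<tau>)\<^sup>2" by linarith
    then show ?thesis unfolding ereal_less_eq by (rule mult_left_mono) (use \<tau>_ge in simp)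
  qed
  finally show ?thesis .
qed

lemma separator: "ereal_of_enat (sep_E W F) \<le> ereal (real (card W) / \<tau> * (log 2 \<tau>)\<^sup>2)"
  using separator_large separator_small by linarith

end

section \<open>Choice of the parameters and assembly\<close>

theorem theorem1:
  fixes n :: nat and k :: real
  assumes "n > 0" and "2 \<le> k" and "k \<le> 1 / 648 * log 2 (log 2 (real n))"
  shows "\<exists>(V :: nat set) E. simple_graph V E \<and> card V = n \<and>
    k \<le> average_degree V E \<and> real (max_degree V E) \<le> 6 * k \<and>
    ereal (log 2 (real n) / (6 * k)\<^sup>2) \<le> ereal_of_enat (girth E) \<and>
    (\<forall>W F t. is_subgraph W F V E \<and> card W = t \<and> log 2 (real n) / (6 * k)\<^sup>2 \<le> real t \<longrightarrow>
       sep_V W F \<le> sep_E W F \<and>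
       ereal_of_enat (sep_E W F) \<le>
         ereal (real t / log 2 (real t) * (log 2 (log 2 (real t)))\<^sup>2))"
proof -
  define a where "a = log 2 (real n)"
  define L where "L = log 2 a"
  define g where "g = a / (6 * k)\<^sup>2"
  define d where "d = nat \<lfloor>a\<rfloor>"
  \<comment> \<open>Rounding up serves both directions: length at least \<open>l\<close> implies
    length at least \<open>g\<close>, while every natural number below \<open>l\<close> is below
    \<open>g\<close>.\<close>
  define l where "l = nat \<lceil>g\<rceil>"
  have kL: "k \<le> L / 648" using assms(3) by (simp add: L_def a_def)
  have L: "1296 \<le> L" using kL assms(2) by linarith
  have "0 \<le> a" using assms(1) by (simp add: a_def)
  \<comment> \<open>The default value of the logarithm at 0 is 0, which the lower bound on
    \<open>L\<close> excludes.\<close>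
  moreover have "a \<noteq> 0" using L by (auto simp: L_def log_def)
  ultimately have aL: "a = 2 powr L" by (simp add: L_def)
  have "L * L \<le> a"
  proof -
    have "L \<le> 2 powr (L / 16)" using L by (intro le_two_powr_16th) simp
    also have "\<dots> \<le> 2 powr (L / 2)" using L by (intro powr_mono) auto
    finally have "L * L \<le> 2 powr (L / 2) * 2 powr (L / 2)" using L by (intro mult_mono) auto
    then show ?thesis by (simp add: aL flip: powr_add)
  qed
  moreover have "1296 * L \<le> L * L" using L by (intro mult_right_mono) auto
  ultimately have a: "1296 * L \<le> a" by linarith
  have d: "real d \<le> a" "a < real d + 1" using a L unfolding d_def by linarith+
  have n: "real n = 2 powr a" using assms(1) by (simp add: a_def)
  have "real (2 ^ d) \<le> real n" using d(1) by (simp add: n flip: powr_realpow)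
  then have dn: "2 ^ d \<le> n" by (simp only: of_nat_le_iff)
  have "real n < 2 powr (real (d + 1))" unfolding n using d(2) by (subst powr_less_cancel_iff) auto
  also have "\<dots> = real (2 ^ (d + 1))" by (subst powr_realpow) auto
  finally have "real n < real (2 ^ (d + 1))" .
  then have nd: "n < 2 ^ (d + 1)" by (simp only: of_nat_less_iff)
  have g0: "0 \<le> g" using a L by (simp add: g_def)
  have l: "g \<le> real l" using g0 unfolding l_def by linarith
  obtain E where E: "E \<subseteq> hypercube_edges d" "\<And>v. v < 2 ^ d \<Longrightarrow> real (degree E v) \<le> 6 * k"
    "\<And>xs. is_cycle E xs \<Longrightarrow> l \<le> length xs" "k * 2 ^ d \<le> real (card E)"
  proof -
    \<comment> \<open>The choice of \<open>g\<close> turns the left side into at most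
      \<open>27 / 36\<close> of \<open>a\<close>, and the remaining quarter outweighs the rounding
      in \<open>d\<close>.\<close>
    have "27 * k\<^sup>2 * real c \<le> real d" if "c < l" for c
    proof -
      have "real c < g" using that g0 unfolding l_def by linarith
      then have "27 * k\<^sup>2 * real c \<le> 27 * k\<^sup>2 * g" by (intro mult_left_mono) auto
      also have "\<dots> = 3 / 4 * a" using assms(2) by (simp add: g_def power2_eq_square field_simps)
      finally show ?thesis using d a L by linarith
    qed
    moreover have "3 * k \<le> real d" using kL d a L by linarith
    ultimately show ?thesis using hypercube_sparse_subgraph[OF assms(2), of d l] that by blast
  qed
  have GE: "simple_graph {..<n} E"
  proof -
    have "simple_graph {..<2 ^ d} E" using E(1) hypercube_graph simple_graph_subset by blast
    moreover have "{..<2 ^ d} \<subseteq> {..<n}" using dn by simp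
    ultimately show ?thesis unfolding simple_graph_def by (meson finite_lessThan order_trans)
  qed
  have deg: "real (degree E v) \<le> 6 * k" for v
  proof (cases "v < 2 ^ d")
    case False
    have "e \<subseteq> {..<2 ^ d}" if "e \<in> E" for e
      using that E(1) hypercube_graph[of d] by (auto simp: simple_graph_def)
    then have "{e \<in> E. v \<in> e} = {}" using False by blast
    then have "degree E v = 0" by (simp only: degree_def card.empty)
    then show ?thesis using assms(2) by simp
  qed (rule E(2))
  show ?thesis
  proof (intro exI conjI allI impI)
    show "simple_graph {..<n} E" by (rule GE)
    show "card {..<n} = n" by simp
    \<comment> \<open>The cube contains at least half of the vertices, so \<open>k * 2 ^ d\<close>
      edges give average degree at least \<open>k\<close> despite the isolated ones.\<close>
    have "real n \<le> 2 * 2 ^ d" using of_nat_mono[OF less_imp_le[OF nd], where 'a = real] by simp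
    then have "k * real n \<le> k * (2 * 2 ^ d)" using assms(2) by (intro mult_left_mono) auto
    also have "\<dots> \<le> 2 * real (card E)" using E(4) by simp
    also have "\<dots> = (\<Sum>v<n. real (degree E v))" using handshake[OF GE] by (simp flip: of_nat_sum)
    finally show "k \<le> average_degree {..<n} E" using assms(1) by (simp add: average_degree_def field_simps)
    have "max_degree {..<n} E \<in> degree E ` {..<n}"
      unfolding max_degree_def using assms(1) by (intro Max_in) auto
    then show "real (max_degree {..<n} E) \<le> 6 * k" using deg by auto
    have "enat l \<le> girth E" unfolding girth_def using E(3) by (intro INF_greatest) auto
    then have "ereal (real l) \<le> ereal_of_enat (girth E)"
      by (metis ereal_of_enat_le_iff ereal_of_enat_simps(1))
    moreover have "ereal g \<le> ereal (real l)" using l by simp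
    ultimately have "ereal g \<le> ereal_of_enat (girth E)" by (rule order_trans[rotated])
    then show "ereal (log 2 (real n) / (6 * k)\<^sup>2) \<le> ereal_of_enat (girth E)"
      by (simp add: g_def a_def)
    fix W F t assume H: "is_subgraph W F {..<n} E \<and> card W = t \<and> log 2 (real n) / (6 * k)\<^sup>2 \<le> real t"
    then have WF: "simple_graph W F" "W \<subseteq> {..<n}" "F \<subseteq> E" by (auto simp: is_subgraph_def)
    show "sep_V W F \<le> sep_E W F" by (rule sep_V_le_sep_E[OF WF(1)])
    interpret sparse_hypercube_subgraph W F d k a L g "log 2 (real t)"
    proof
      show "W \<subseteq> {..<2 ^ (d + 1)}" using WF(2) nd by auto
      show "\<exists>x i. i < d + 1 \<and> e = {x, flip_bit i x}" if "e \<in> F" for e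
      proof -
        have "e \<in> hypercube_edges d" using that WF(3) E(1) by blast
        then obtain x i where "i < d" "e = {x, flip_bit i x}" by (auto simp: hypercube_edges_def)
        then show ?thesis by (intro exI[of _ x] exI[of _ i]) simp
      qed
      show "real (degree F v) \<le> 6 * k" for v
        using degree_mono[OF simple_graph_finite_edges[OF GE] WF(3), of v] deg[of v] by linarith
      show "g \<le> real (length xs)" if "is_cycle F xs" for xs
        using E(3)[OF is_cycle_mono[OF that WF(3)]] l by linarith
    qed (use H WF kL aL d assms(2) in \<open>auto simp: g_def a_def\<close>)
    show "ereal_of_enat (sep_E W F) \<le> ereal (real t / log 2 (real t) * (log 2 (log 2 (real t)))\<^sup>2)"
      using separator H by simp
  qed
qed

end
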